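(* The map $\pi\colon \mathcal{D}\to U(\mathfrak{sl}_2(\Bbbk))$ induces a bijection $\operatorname{irrep}\mathcal{D}\simeq \operatorname{irrep} U(\mathfrak{sl}_2(\Bbbk))$; that is, sending a finite-dimensional simple $U(\mathfrak{sl}_2(\Bbbk))$-module $L$ to the $\mathcal{D}$-module obtained from $L$ by restriction of scalars along $\pi$ defines a bijection from $\operatorname{irrep} U(\mathfrak{sl}_2(\Bbbk))$ onto $\operatorname{irrep}\mathcal{D}$.
   Context: $\Bbbk$ is an algebraically closed field of characteristic $0$. The algebra $\mathcal{D}$ (the double of the Jordan plane) is the associative unital $\Bbbk$-algebra with generators $u, v, \zeta, g^{\pm1}, x, y$ and relations $g^{\pm1}g^{\mp1}=1$, $\zeta g=g\zeta$, $gx=xg$, $gy=yg+xg$, $\zeta y=y\zeta+y$, $\zeta x=x\zeta+x$, $ug=gu$, $vg=gv+gu$, $v\zeta=\zeta v+v$, $u\zeta=\zeta u+u$, $yx=xy-\frac12x^2$, $vu=uv-\frac12u^2$, $ux=xu$, $vx=xv+(1-g)+xu$, $uy=yu+(1-g)$, $vy=yv-g\zeta+yu$. Let $e,f,h$ be the Chevalley generators of $\mathfrak{sl}_2(\Bbbk)$: $[e,f]=h$, $[h,e]=2e$, $[h,f]=-2f$. The map $\pi\colon\mathcal{D}\to U(\mathfrak{sl}_2(\Bbbk))$ is the algebra map (in fact a Hopf algebra map) determined by $\pi(v)=\frac14 e$, $\pi(y)=2f$, $\pi(\zeta)=-\frac12h$, $\pi(u)=\pi(x)=\pi(g-1)=0$.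 For an algebra $A$, $\operatorname{irrep}A$ is the set of isomorphism classes of finite-dimensional simple left $A$-modules. *)

theory Defs
  imports
    "HOL-Analysis.Determinants"
    "HOL-Algebra.QuotRing"
    "HOL-Algebra.Module"
    "HOL-Algebra.Algebraic_Closure_Type"
    "HOL-Library.Poly_Mapping"
begin

section \<open>Associative algebras given by generators and relations\<close>

text \<open>
  The base field is the type \<open>'k\<close>.  A (not necessarily commutative) associative unital algebra is
  a record of type \<open>('k, 'a) module\<close>: a ring together with multiplication by scalars.
\<close>

datatype 'x word = Word (letters: "'x list")

instantiation word :: (type) monoid_add
begin

definition zero_word :: "'a word" where
  "zero_word = Word []"

definition plus_word :: "'a word \<Rightarrow> 'a word \<Rightarrow> 'a word" where
  "plus_word v w = Word (letters v @ letters w)"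

instance
  by standard (simp_all add: zero_word_def plus_word_def)

end

text \<open>
  Concatenation being the addition of words, the convolution product on finitely supported
  functions \<open>'x word \<Rightarrow>\<^sub>0 'k\<close> is the product of noncommutative polynomials.
\<close>

type_synonym ('x, 'k) ncpoly = "'x word \<Rightarrow>\<^sub>0 'k"

definition scalar :: "'k::field \<Rightarrow> ('x, 'k) ncpoly" where
  "scalar c = Poly_Mapping.single 0 c"

definition gen :: "'x \<Rightarrow> ('x, 'k::field) ncpoly" where
  "gen x = Poly_Mapping.single (Word [x]) 1"

definition free_algebra :: "'x set \<Rightarrow> ('x, 'k::field) ncpoly ring" where
  "free_algebra S =
     ring_of_type_algebra\<lparr>carrier := {p. \<forall>w \<in> Poly_Mapping.keys p. set (letters w) \<subseteq> S}\<rparr>"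

definition presented_algebra ::
  "'x set \<Rightarrow> ('x, 'k::field) ncpoly set \<Rightarrow> ('k, ('x, 'k) ncpoly set) module" where
  "presented_algebra S R =
     (let F = free_algebra S; I = Idl\<^bsub>F\<^esub> R; Q = F Quot I in
       \<lparr>carrier = carrier Q, monoid.mult = monoid.mult Q, one = one Q,
        zero = zero Q, add = add Q,
        module.smult = (\<lambda>c a. (I +>\<^bsub>F\<^esub> scalar c) \<otimes>\<^bsub>Q\<^esub> a)\<rparr>)"

definition presented_gen ::
  "'x set \<Rightarrow> ('x, 'k::field) ncpoly set \<Rightarrow> 'x \<Rightarrow> ('x, 'k) ncpoly set" where
  "presented_gen S R x = (Idl\<^bsub>free_algebra S\<^esub> R) +>\<^bsub>free_algebra S\<^esub> gen x"

definition algebra_hom ::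
  "('k, 'a) module \<Rightarrow> ('k, 'b) module \<Rightarrow> ('a \<Rightarrow> 'b) \<Rightarrow> bool" where
  "algebra_hom A B \<phi> \<longleftrightarrow> \<phi> \<in> ring_hom A B \<and>
     (\<forall>c. \<forall>a \<in> carrier A. \<phi> (c \<odot>\<^bsub>A\<^esub> a) = c \<odot>\<^bsub>B\<^esub> \<phi> a)"


section \<open>The double of the Jordan plane\<close>

datatype djgen = Gen_u | Gen_v | Gen_zeta | Gen_g | Gen_ginv | Gen_x | Gen_y

definition double_jordan_relations :: "(djgen, 'k::field) ncpoly set" where
  "double_jordan_relations =
     (let u = gen Gen_u; v = gen Gen_v; \<zeta> = gen Gen_zeta; g = gen Gen_g; g' = gen Gen_ginv;
          x = gen Gen_x; y = gen Gen_y; half = scalar (1 / 2)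
      in {g * g' - 1,
          g' * g - 1,
          \<zeta> * g - g * \<zeta>,
          g * x - x * g,
          g * y - (y * g + x * g),
          \<zeta> * y - (y * \<zeta> + y),
          \<zeta> * x - (x * \<zeta> + x),
          u * g - g * u,
          v * g - (g * v + g * u),
          v * \<zeta> - (\<zeta> * v + v),
          u * \<zeta> - (\<zeta> * u + u),
          y * x - (x * y - half * x ^ 2),
          v * u - (u * v - half * u ^ 2),
          u * x - x * u,
          v * x - (x * v + (1 - g) + x * u),
          u * y - (y * u + (1 - g)),
          v * y - (y * v - g * \<zeta> + y * u)})"

definition double_jordan :: "('k::field, (djgen, 'k) ncpoly set) module" where
  "double_jordan = presented_algebra UNIV double_jordan_relations"

definition double_jordan_gen :: "djgen \<Rightarrow> (djgen, 'k::field) ncpoly set" where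
  "double_jordan_gen = presented_gen UNIV double_jordan_relations"


section \<open>The enveloping algebra of the Lie algebra of traceless two by two matrices\<close>

text \<open>
  The linearity relations turn the free algebra on the set \<open>L\<close> into the tensor algebra of the
  vector space \<open>L\<close>.
\<close>

definition enveloping_relations ::
  "'l::ab_group_add set \<Rightarrow> ('k \<Rightarrow> 'l \<Rightarrow> 'l) \<Rightarrow> ('l \<Rightarrow> 'l \<Rightarrow> 'l) \<Rightarrow> ('l, 'k::field) ncpoly set" where
  "enveloping_relations L sc bracket =
     {gen (a + b) - (gen a + gen b) | a b. a \<in> L \<and> b \<in> L} \<union>
     {gen (sc c a) - scalar c * gen a | c a. a \<in> L} \<union>
     {gen a * gen b - gen b * gen a - gen (bracket a b) | a b. a \<in> L \<and> b \<in> L}"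

type_synonym 'k mat2 = "'k ^ 2 ^ 2"

definition sl2 :: "'k::field mat2 set" where
  "sl2 = {a. trace a = 0}"

definition matrix_bracket :: "'k::field mat2 \<Rightarrow> 'k mat2 \<Rightarrow> 'k mat2" where
  "matrix_bracket a b = a ** b - b ** a"

definition matrix_scale :: "'k::field \<Rightarrow> 'k mat2 \<Rightarrow> 'k mat2" where
  "matrix_scale c a = (\<chi> i j. c * a $ i $ j)"

definition sl2_relations :: "('k mat2, 'k::field) ncpoly set" where
  "sl2_relations = enveloping_relations sl2 matrix_scale matrix_bracket"

definition U_sl2 :: "('k::field, ('k mat2, 'k) ncpoly set) module" where
  "U_sl2 = presented_algebra sl2 sl2_relations"

definition U_sl2_incl :: "'k::field mat2 \<Rightarrow> ('k mat2, 'k) ncpoly set" where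
  "U_sl2_incl = presented_gen sl2 sl2_relations"

definition sl2_e :: "'k::field mat2" where
  "sl2_e = vector [vector [0, 1], vector [0, 0]]"

definition sl2_f :: "'k::field mat2" where
  "sl2_f = vector [vector [0, 0], vector [1, 0]]"

definition sl2_h :: "'k::field mat2" where
  "sl2_h = vector [vector [1, 0], vector [0, - 1]]"

lemma sl2_chevalley:
  fixes e f h :: "'k::field mat2"
  defines "e \<equiv> sl2_e" and "f \<equiv> sl2_f" and "h \<equiv> sl2_h"
  shows "e \<in> sl2" "f \<in> sl2" "h \<in> sl2"
    and "matrix_bracket e f = h"
    and "matrix_bracket h e = matrix_scale 2 e"
    and "matrix_bracket h f = matrix_scale (- 2) f"
  unfolding e_def f_def h_def
  by (simp_all add: sl2_def trace_def sum_2 sl2_e_def sl2_f_def sl2_h_def matrix_bracket_def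
      matrix_scale_def matrix_matrix_mult_def vec_eq_iff forall_2)


section \<open>The map from the double of the Jordan plane to the enveloping algebra\<close>

definition is_double_jordan_proj ::
  "((djgen, 'k::field) ncpoly set \<Rightarrow> ('k mat2, 'k) ncpoly set) \<Rightarrow> bool" where
  "is_double_jordan_proj \<pi> \<longleftrightarrow> algebra_hom double_jordan U_sl2 \<pi> \<and>
     \<pi> (double_jordan_gen Gen_v) = (1 / 4) \<odot>\<^bsub>U_sl2\<^esub> U_sl2_incl sl2_e \<and>
     \<pi> (double_jordan_gen Gen_y) = 2 \<odot>\<^bsub>U_sl2\<^esub> U_sl2_incl sl2_f \<and>
     \<pi> (double_jordan_gen Gen_zeta) = (- 1 / 2) \<odot>\<^bsub>U_sl2\<^esub> U_sl2_incl sl2_h \<and>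
     \<pi> (double_jordan_gen Gen_u) = \<zero>\<^bsub>U_sl2\<^esub> \<and>
     \<pi> (double_jordan_gen Gen_x) = \<zero>\<^bsub>U_sl2\<^esub> \<and>
     \<pi> (double_jordan_gen Gen_g \<ominus>\<^bsub>double_jordan\<^esub> \<one>\<^bsub>double_jordan\<^esub>) = \<zero>\<^bsub>U_sl2\<^esub>"

text \<open>
  Extensionality fixes the values outside the carrier, so that the description below determines
  the map; see \<open>double_jordan_proj_ex1\<close> at the end of this theory.
\<close>

definition double_jordan_proj ::
  "(djgen, 'k::field) ncpoly set \<Rightarrow> ('k mat2, 'k) ncpoly set" where
  "double_jordan_proj =
     (THE \<pi>. \<pi> \<in> extensional (carrier double_jordan) \<and> is_double_jordan_proj \<pi>)"


section \<open>Finite-dimensional simple left modules\<close>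

text \<open>The locale \<open>Module.module\<close> without commutativity of the ring.\<close>

locale left_module = R?: ring R + M?: abelian_group M
  for R :: "('a, 'r) ring_scheme" (structure) and M :: "('a, 'm) module" (structure) +
  assumes smult_closed [simp, intro]:
      "\<lbrakk>a \<in> carrier R; m \<in> carrier M\<rbrakk> \<Longrightarrow> a \<odot>\<^bsub>M\<^esub> m \<in> carrier M"
    and smult_l_distr:
      "\<lbrakk>a \<in> carrier R; b \<in> carrier R; m \<in> carrier M\<rbrakk> \<Longrightarrow>
      (a \<oplus> b) \<odot>\<^bsub>M\<^esub> m = a \<odot>\<^bsub>M\<^esub> m \<oplus>\<^bsub>M\<^esub> b \<odot>\<^bsub>M\<^esub> m"
    and smult_r_distr:
      "\<lbrakk>a \<in> carrier R; m \<in> carrier M; n \<in> carrier M\<rbrakk> \<Longrightarrow>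
      a \<odot>\<^bsub>M\<^esub> (m \<oplus>\<^bsub>M\<^esub> n) = a \<odot>\<^bsub>M\<^esub> m \<oplus>\<^bsub>M\<^esub> a \<odot>\<^bsub>M\<^esub> n"
    and smult_assoc1:
      "\<lbrakk>a \<in> carrier R; b \<in> carrier R; m \<in> carrier M\<rbrakk> \<Longrightarrow>
      (a \<otimes> b) \<odot>\<^bsub>M\<^esub> m = a \<odot>\<^bsub>M\<^esub> (b \<odot>\<^bsub>M\<^esub> m)"
    and smult_one [simp]:
      "m \<in> carrier M \<Longrightarrow> \<one> \<odot>\<^bsub>M\<^esub> m = m"

text \<open>The base field acts on a module over the algebra \<open>A\<close> through its image \<open>c \<cdot> 1\<close> in \<open>A\<close>.\<close>

definition base_smult :: "('k, 'a) module \<Rightarrow> ('a, 'm) module \<Rightarrow> 'k \<Rightarrow> 'm \<Rightarrow> 'm" where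
  "base_smult A M c m = (c \<odot>\<^bsub>A\<^esub> \<one>\<^bsub>A\<^esub>) \<odot>\<^bsub>M\<^esub> m"

definition finite_dimensional_module :: "('k, 'a) module \<Rightarrow> ('a, 'm) module \<Rightarrow> bool" where
  "finite_dimensional_module A M \<longleftrightarrow>
     (\<exists>B. finite B \<and> B \<subseteq> carrier M \<and>
       (\<forall>m \<in> carrier M. \<exists>c. m = (\<Oplus>\<^bsub>M\<^esub>b\<in>B. base_smult A M (c b) b)))"

definition simple_module :: "('k, 'a) module \<Rightarrow> ('a, 'm) module \<Rightarrow> bool" where
  "simple_module A M \<longleftrightarrow> left_module A M \<and> carrier M \<noteq> {\<zero>\<^bsub>M\<^esub>} \<and>
     (\<forall>N. submodule N A M \<longrightarrow> N = {\<zero>\<^bsub>M\<^esub>} \<or> N = carrier M)"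

definition fd_simple_module :: "('k, 'a) module \<Rightarrow> ('a, 'm) module \<Rightarrow> bool" where
  "fd_simple_module A M \<longleftrightarrow> simple_module A M \<and> finite_dimensional_module A M"

definition module_iso :: "('k, 'a) module \<Rightarrow> ('a, 'm) module \<Rightarrow> ('a, 'n) module \<Rightarrow> bool" where
  "module_iso A M N \<longleftrightarrow> (\<exists>\<phi>. bij_betw \<phi> (carrier M) (carrier N) \<and>
     (\<forall>m \<in> carrier M. \<forall>m' \<in> carrier M. \<phi> (m \<oplus>\<^bsub>M\<^esub> m') = \<phi> m \<oplus>\<^bsub>N\<^esub> \<phi> m') \<and>
     (\<forall>a \<in> carrier A. \<forall>m \<in> carrier M. \<phi> (a \<odot>\<^bsub>M\<^esub> m) = a \<odot>\<^bsub>N\<^esub> \<phi> m))"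

definition iso_class :: "('k, 'a) module \<Rightarrow> ('a, 'm) module \<Rightarrow> ('a, 'm) module set" where
  "iso_class A M = {N. left_module A N \<and> module_iso A M N}"

text \<open>
  Isomorphism classes are taken among the modules whose elements lie in the type \<open>'m\<close>.  For
  \<open>'m = nat \<Rightarrow> 'k\<close> every finite-dimensional module has an isomorphic copy among these.
\<close>

definition irrep :: "('k, 'a) module \<Rightarrow> ('a, 'm) module set set" where
  "irrep A = {iso_class A M | M. fd_simple_module A M}"

definition restrict_scalars :: "('a \<Rightarrow> 'b) \<Rightarrow> ('b, 'm) module \<Rightarrow> ('a, 'm) module" where
  "restrict_scalars \<phi> M =
     \<lparr>carrier = carrier M, monoid.mult = monoid.mult M, one = one M,
      zero = zero M, add = add M, module.smult = (\<lambda>a m. \<phi> a \<odot>\<^bsub>M\<^esub> m)\<rparr>"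


section \<open>Existence and uniqueness of the projection\<close>

lemma free_algebra_simps:
  "carrier (free_algebra S) = {p. \<forall>w \<in> Poly_Mapping.keys p. set (letters w) \<subseteq> S}"
  "p \<otimes>\<^bsub>free_algebra S\<^esub> q = p * q" "p \<oplus>\<^bsub>free_algebra S\<^esub> q = p + q"
  "\<one>\<^bsub>free_algebra S\<^esub> = 1" "\<zero>\<^bsub>free_algebra S\<^esub> = 0"
  by (simp_all add: free_algebra_def ring_of_type_algebra_def)

lemma free_algebra_closed:
  fixes p q :: "('x, 'k::field) ncpoly"
  shows "(0 :: ('x, 'k) ncpoly) \<in> carrier (free_algebra S)"
    and "(1 :: ('x, 'k) ncpoly) \<in> carrier (free_algebra S)"
    and "(scalar c :: ('x, 'k) ncpoly) \<in> carrier (free_algebra S)"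
    and "x \<in> S \<Longrightarrow> (gen x :: ('x, 'k) ncpoly) \<in> carrier (free_algebra S)"
    and "p \<in> carrier (free_algebra S) \<Longrightarrow> - p \<in> carrier (free_algebra S)"
    and "\<lbrakk>p \<in> carrier (free_algebra S); q \<in> carrier (free_algebra S)\<rbrakk> \<Longrightarrow> p + q \<in> carrier (free_algebra S)"
    and "\<lbrakk>p \<in> carrier (free_algebra S); q \<in> carrier (free_algebra S)\<rbrakk> \<Longrightarrow> p - q \<in> carrier (free_algebra S)"
    and "\<lbrakk>p \<in> carrier (free_algebra S); q \<in> carrier (free_algebra S)\<rbrakk> \<Longrightarrow> p * q \<in> carrier (free_algebra S)"
proof -
  have neg: "- q \<in> carrier (free_algebra S)" if "q \<in> carrier (free_algebra S)" for q :: "('x, 'k) ncpoly"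
    using that by (auto simp: free_algebra_simps(1) in_keys_iff)
  have add: "p + q \<in> carrier (free_algebra S)"
    if "p \<in> carrier (free_algebra S)" "q \<in> carrier (free_algebra S)" for p q :: "('x, 'k) ncpoly"
    using that Poly_Mapping.keys_add[of p q] unfolding free_algebra_simps(1) by blast
  show "p \<in> carrier (free_algebra S) \<Longrightarrow> - p \<in> carrier (free_algebra S)"
    by (rule neg)
  show "\<lbrakk>p \<in> carrier (free_algebra S); q \<in> carrier (free_algebra S)\<rbrakk> \<Longrightarrow> p + q \<in> carrier (free_algebra S)"
    by (rule add)
  show "\<lbrakk>p \<in> carrier (free_algebra S); q \<in> carrier (free_algebra S)\<rbrakk> \<Longrightarrow> p - q \<in> carrier (free_algebra S)"
    using add[OF _ neg, of p q] by simp
  show "p * q \<in> carrier (free_algebra S)"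
    if "p \<in> carrier (free_algebra S)" "q \<in> carrier (free_algebra S)"
  proof -
    have "set (letters w) \<subseteq> S" if w: "w \<in> Poly_Mapping.keys (p * q)" for w
    proof -
      obtain a b where "a \<in> Poly_Mapping.keys p" "b \<in> Poly_Mapping.keys q" "w = a + b"
        using w keys_mult[of p q] by blast
      then show ?thesis
        using \<open>p \<in> _\<close> \<open>q \<in> _\<close> by (auto simp: free_algebra_simps(1) plus_word_def)
    qed
    then show ?thesis by (simp add: free_algebra_simps(1))
  qed
qed (simp_all add: free_algebra_simps(1) scalar_def gen_def zero_word_def)

lemma ring_free_algebra: "ring (free_algebra S)"
proof (intro ringI abelian_groupI monoidI)
  show "\<exists>q \<in> carrier (free_algebra S). q \<oplus>\<^bsub>free_algebra S\<^esub> p = \<zero>\<^bsub>free_algebra S\<^esub>"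
    if "p \<in> carrier (free_algebra S)" for p :: "('a, 'b) ncpoly"
    by (rule bexI[of _ "- p"]) (simp_all add: free_algebra_simps(2-) free_algebra_closed(5) that)
qed (simp_all only: free_algebra_simps(2-) free_algebra_closed algebra_simps mult_1_left mult_1_right add_0_left add_0_right)

lemma scalar_simps:
  "scalar 0 = 0" "scalar 1 = 1" "scalar (a + b) = scalar a + scalar b"
  "scalar (a * b) = scalar a * scalar b" "scalar (- a) = - scalar a"
  by (simp_all add: scalar_def single_add mult_single single_uminus)

lemma ncpoly_expand:
  fixes p :: "('x, 'k::field) ncpoly"
  shows "p = (\<Sum>w\<in>Poly_Mapping.keys p. Poly_Mapping.single w (Poly_Mapping.lookup p w))"
proof (rule poly_mapping_eqI)
  fix v
  show "Poly_Mapping.lookup p v =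
    Poly_Mapping.lookup (\<Sum>w\<in>Poly_Mapping.keys p. Poly_Mapping.single w (Poly_Mapping.lookup p w)) v"
    by (cases "v \<in> Poly_Mapping.keys p")
       (auto simp: lookup_sum lookup_single when_def in_keys_iff)
qed

lemma single_Word:
  "Poly_Mapping.single (Word xs) c = scalar c * prod_list (map gen xs)"
proof (induction xs)
  case Nil
  then show ?case by (simp add: scalar_def zero_word_def)
next
  case (Cons x xs)
  have "Poly_Mapping.single (Word (x # xs)) c = gen x * Poly_Mapping.single (Word xs) c"
    by (simp add: gen_def mult_single plus_word_def)
  moreover have "gen x * scalar c = scalar c * gen x"
    by (simp add: gen_def scalar_def mult_single)
  ultimately show ?case
    by (simp add: Cons flip: mult.assoc)
qed

lemma scalar_commute: "scalar c * p = p * scalar c"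
proof -
  have "scalar c * (\<Sum>w\<in>Poly_Mapping.keys p. Poly_Mapping.single w (Poly_Mapping.lookup p w)) =
        (\<Sum>w\<in>Poly_Mapping.keys p. Poly_Mapping.single w (Poly_Mapping.lookup p w)) * scalar c"
    by (simp add: sum_distrib_left sum_distrib_right scalar_def mult_single mult.commute)
  then show ?thesis using ncpoly_expand[of p] by simp
qed

lemma scalar_left_commute: "p * (scalar c * q) = scalar c * (p * q)"
  by (simp add: scalar_commute[of c p] flip: mult.assoc)

lemma free_algebra_induct [consumes 1, case_names scalar gen add mult]:
  assumes "p \<in> carrier (free_algebra S)"
    and "\<And>c. P (scalar c)" "\<And>x. x \<in> S \<Longrightarrow> P (gen x)"
    and add: "\<And>p q. \<lbrakk>p \<in> carrier (free_algebra S); q \<in> carrier (free_algebra S); P p; P q\<rbrakk> \<Longrightarrow> P (p + q)"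
    and mult: "\<And>p q. \<lbrakk>p \<in> carrier (free_algebra S); q \<in> carrier (free_algebra S); P p; P q\<rbrakk> \<Longrightarrow> P (p * q)"
  shows "P p"
proof -
  let ?C = "{p \<in> carrier (free_algebra S). P p}"
  have 0: "0 \<in> ?C" and 1: "1 \<in> ?C"
    using assms(2)[of 0] assms(2)[of 1] by (auto simp: scalar_simps free_algebra_closed)
  have "prod_list (map gen xs) \<in> ?C" if "set xs \<subseteq> S" for xs
    using that
  proof (induction xs)
    case Nil
    then show ?case using 1 by simp
  next
    case (Cons x xs)
    then show ?case using assms(3)[of x] mult[of "gen x" "prod_list (map gen xs)"]
      by (auto simp: free_algebra_closed)
  qed
  then have single: "Poly_Mapping.single w c \<in> ?C" if "set (letters w) \<subseteq> S" for w c
    using that mult[of "scalar c" "prod_list (map gen (letters w))"] assms(2)[of c] single_Word[of "letters w" c]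
    by (auto simp: free_algebra_closed)
  have sumC: "sum g W \<in> ?C" if "finite W" "\<And>w. w \<in> W \<Longrightarrow> g w \<in> ?C"
    for g and W :: "'a word set"
    using that by (induction W rule: finite_induct) (use 0 add in \<open>auto simp: free_algebra_closed\<close>)
  have "(\<Sum>w\<in>Poly_Mapping.keys p. Poly_Mapping.single w (Poly_Mapping.lookup p w)) \<in> ?C"
    using assms(1) by (intro sumC single) (simp_all add: free_algebra_simps)
  then show ?thesis using ncpoly_expand[of p] by auto
qed

definition ncpoly_subst :: "('x \<Rightarrow> ('y, 'k) ncpoly) \<Rightarrow> ('x, 'k::field) ncpoly \<Rightarrow> ('y, 'k) ncpoly" where
  "ncpoly_subst f p =
     (\<Sum>w\<in>Poly_Mapping.keys p. scalar (Poly_Mapping.lookup p w) * prod_list (map f (letters w)))"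

lemma ncpoly_subst_superset:
  assumes "finite W" "Poly_Mapping.keys p \<subseteq> W"
  shows "ncpoly_subst f p = (\<Sum>w\<in>W. scalar (Poly_Mapping.lookup p w) * prod_list (map f (letters w)))"
  unfolding ncpoly_subst_def using assms
  by (intro sum.mono_neutral_left) (auto simp: in_keys_iff scalar_simps)

lemma ncpoly_subst_add: "ncpoly_subst f (p + q) = ncpoly_subst f p + ncpoly_subst f q"
proof -
  let ?W = "Poly_Mapping.keys p \<union> Poly_Mapping.keys q"
  show ?thesis
    using Poly_Mapping.keys_add[of p q]
    by (simp add: ncpoly_subst_superset[of ?W] lookup_add scalar_simps algebra_simps sum.distrib)
qed

lemma ncpoly_subst_single:
  "ncpoly_subst f (Poly_Mapping.single w c) = scalar c * prod_list (map f (letters w))"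
  by (simp add: ncpoly_subst_superset[of "{w}"])

lemma ncpoly_subst_0 [simp]: "ncpoly_subst f 0 = 0"
  by (simp add: ncpoly_subst_def)

lemma ncpoly_subst_scalar [simp]: "ncpoly_subst f (scalar c) = scalar c"
  by (simp add: scalar_def[of c] ncpoly_subst_single) (simp add: zero_word_def scalar_def)

lemma ncpoly_subst_1 [simp]: "ncpoly_subst f 1 = 1"
  using ncpoly_subst_scalar[of f 1] by (simp add: scalar_simps)

lemma ncpoly_subst_gen [simp]: "ncpoly_subst f (gen x) = f x"
  by (simp add: gen_def ncpoly_subst_single scalar_simps)

lemma ncpoly_subst_uminus: "ncpoly_subst f (- p) = - ncpoly_subst f p"
  using ncpoly_subst_add[of f p "- p"] by (simp add: eq_neg_iff_add_eq_0 add.commute)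

lemma ncpoly_subst_diff: "ncpoly_subst f (p - q) = ncpoly_subst f p - ncpoly_subst f q"
  using ncpoly_subst_add[of f p "- q"] by (simp add: ncpoly_subst_uminus)

lemma ncpoly_subst_sum: "ncpoly_subst f (sum g W) = (\<Sum>w\<in>W. ncpoly_subst f (g w))"
  by (induction W rule: infinite_finite_induct) (simp_all add: ncpoly_subst_add)

lemma ncpoly_subst_mult: "ncpoly_subst f (p * q) = ncpoly_subst f p * ncpoly_subst f q"
proof -
  have 1: "ncpoly_subst f (Poly_Mapping.single v c * Poly_Mapping.single w d) =
    ncpoly_subst f (Poly_Mapping.single v c) * ncpoly_subst f (Poly_Mapping.single w d)" for v w c d
    using scalar_left_commute[of "prod_list (map f (letters v))" d "prod_list (map f (letters w))"]
    by (simp add: mult_single ncpoly_subst_single plus_word_def scalar_simps(4) mult.assoc)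
  have "ncpoly_subst f
    ((\<Sum>w\<in>Poly_Mapping.keys p. Poly_Mapping.single w (Poly_Mapping.lookup p w)) *
     (\<Sum>w\<in>Poly_Mapping.keys q. Poly_Mapping.single w (Poly_Mapping.lookup q w))) =
    ncpoly_subst f (\<Sum>w\<in>Poly_Mapping.keys p. Poly_Mapping.single w (Poly_Mapping.lookup p w)) *
    ncpoly_subst f (\<Sum>w\<in>Poly_Mapping.keys q. Poly_Mapping.single w (Poly_Mapping.lookup q w))"
    by (simp only: sum_product ncpoly_subst_sum 1)
  then show ?thesis using ncpoly_expand[of p] ncpoly_expand[of q] by simp
qed

lemmas ncpoly_subst_simps = ncpoly_subst_add ncpoly_subst_diff ncpoly_subst_mult

lemma ncpoly_subst_closed:
  assumes "\<And>x. x \<in> S \<Longrightarrow> f x \<in> carrier (free_algebra T)" "p \<in> carrier (free_algebra S)"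
  shows "ncpoly_subst f p \<in> carrier (free_algebra T)"
  using assms(2)
  by (induction rule: free_algebra_induct) (auto simp: ncpoly_subst_simps free_algebra_closed assms(1))


lemma presented_algebra_simps:
  fixes S :: "'x set" and R :: "('x, 'k::field) ncpoly set"
  defines "F \<equiv> free_algebra S"
  defines "I \<equiv> Idl\<^bsub>F\<^esub> R" and "A \<equiv> presented_algebra S R"
  assumes R: "R \<subseteq> carrier F"
  shows "ideal I F" "R \<subseteq> I"
    and "ring A" "((+>\<^bsub>F\<^esub>) I) \<in> ring_hom F A"
    and "carrier A = (+>\<^bsub>F\<^esub>) I ` carrier F"
    and "\<lbrakk>p \<in> carrier F; q \<in> carrier F\<rbrakk> \<Longrightarrow> I +>\<^bsub>F\<^esub> p = I +>\<^bsub>F\<^esub> q \<longleftrightarrow> p - q \<in> I"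
    and "\<lbrakk>p \<in> carrier F; q \<in> carrier F\<rbrakk> \<Longrightarrow> (I +>\<^bsub>F\<^esub> p) \<otimes>\<^bsub>A\<^esub> (I +>\<^bsub>F\<^esub> q) = I +>\<^bsub>F\<^esub> (p * q)"
    and "\<lbrakk>p \<in> carrier F; q \<in> carrier F\<rbrakk> \<Longrightarrow> (I +>\<^bsub>F\<^esub> p) \<oplus>\<^bsub>A\<^esub> (I +>\<^bsub>F\<^esub> q) = I +>\<^bsub>F\<^esub> (p + q)"
    and "\<one>\<^bsub>A\<^esub> = I +>\<^bsub>F\<^esub> 1" "\<zero>\<^bsub>A\<^esub> = I +>\<^bsub>F\<^esub> 0"
    and "p \<in> carrier F \<Longrightarrow> c \<odot>\<^bsub>A\<^esub> (I +>\<^bsub>F\<^esub> p) = I +>\<^bsub>F\<^esub> (scalar c * p)"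
proof -
  interpret F: ring F
    unfolding F_def by (rule ring_free_algebra)
  show "ideal I F" unfolding I_def using R by (rule F.genideal_ideal)
  then interpret ideal I F .
  show "R \<subseteq> I" unfolding I_def using R by (rule F.genideal_self)
  have sel: "carrier A = carrier (F Quot I)" "monoid.mult A = monoid.mult (F Quot I)"
    "one A = one (F Quot I)" "zero A = zero (F Quot I)" "add A = add (F Quot I)"
    "\<And>c a. c \<odot>\<^bsub>A\<^esub> a = (I +>\<^bsub>F\<^esub> scalar c) \<otimes>\<^bsub>F Quot I\<^esub> a"
    by (simp_all add: A_def presented_algebra_def I_def F_def Let_def)
  interpret Q: ring "F Quot I" by (rule quotient_is_ring)
  have "monoid A" using Q.monoid_axioms unfolding Group.monoid_def sel .
  moreover have "abelian_group A"
  proof (intro abelian_groupI, unfold sel)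
    show "\<exists>y \<in> carrier (F Quot I). y \<oplus>\<^bsub>F Quot I\<^esub> x = \<zero>\<^bsub>F Quot I\<^esub>"
      if "x \<in> carrier (F Quot I)" for x
      using Q.l_neg[OF that] Q.a_inv_closed[OF that] by blast
  qed (fact Q.a_closed Q.zero_closed Q.a_assoc Q.a_comm Q.l_zero)+
  moreover have "ring_axioms A"
    unfolding ring_axioms_def sel by (intro conjI allI impI Q.l_distr Q.r_distr)
  ultimately show "ring A" by (intro ring.intro)
  have hom: "((+>\<^bsub>F\<^esub>) I) \<in> ring_hom F (F Quot I)" by (rule rcos_ring_hom)
  then show "((+>\<^bsub>F\<^esub>) I) \<in> ring_hom F A" by (simp add: ring_hom_def sel)
  show "carrier A = (+>\<^bsub>F\<^esub>) I ` carrier F"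
    unfolding sel by (auto simp: FactRing_def A_RCOSETS_defs a_r_coset_def)
  have minus: "p \<ominus>\<^bsub>F\<^esub> q = p - q" if "p \<in> carrier F" "q \<in> carrier F" for p q
  proof -
    have "\<ominus>\<^bsub>F\<^esub> q = - q"
      by (rule F.minus_equality) (use that in \<open>auto simp: F_def free_algebra_simps(2-) free_algebra_closed\<close>)
    then show ?thesis by (simp add: a_minus_def F_def free_algebra_simps)
  qed
  show "I +>\<^bsub>F\<^esub> p = I +>\<^bsub>F\<^esub> q \<longleftrightarrow> p - q \<in> I" if "p \<in> carrier F" "q \<in> carrier F"
    using F.quotient_eq_iff_same_a_r_cos[OF \<open>ideal I F\<close> that] minus[OF that] by simp
  show mult: "(I +>\<^bsub>F\<^esub> p) \<otimes>\<^bsub>A\<^esub> (I +>\<^bsub>F\<^esub> q) = I +>\<^bsub>F\<^esub> (p * q)" if "p \<in> carrier F" "q \<in> carrier F" for p q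
    using ring_hom_mult[OF hom that] by (simp add: sel F_def free_algebra_simps)
  show "(I +>\<^bsub>F\<^esub> p) \<oplus>\<^bsub>A\<^esub> (I +>\<^bsub>F\<^esub> q) = I +>\<^bsub>F\<^esub> (p + q)" if "p \<in> carrier F" "q \<in> carrier F"
    using ring_hom_add[OF hom that] by (simp add: sel F_def free_algebra_simps)
  show "\<one>\<^bsub>A\<^esub> = I +>\<^bsub>F\<^esub> 1"
    using ring_hom_one[OF hom] by (simp add: sel F_def free_algebra_simps)
  show "\<zero>\<^bsub>A\<^esub> = I +>\<^bsub>F\<^esub> 0"
    using ring_hom_zero[OF hom F.ring_axioms Q.ring_axioms] by (simp add: sel F_def free_algebra_simps)
  show "c \<odot>\<^bsub>A\<^esub> (I +>\<^bsub>F\<^esub> p) = I +>\<^bsub>F\<^esub> (scalar c * p)" if "p \<in> carrier F"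
    using mult[of "scalar c" p] that by (simp add: sel F_def free_algebra_closed)
qed

lemma presented_algebra_hom_exists:
  assumes R: "R \<subseteq> carrier (free_algebra S)" and R': "R' \<subseteq> carrier (free_algebra T)"
    and f: "\<And>x. x \<in> S \<Longrightarrow> f x \<in> carrier (free_algebra T)"
    and rel: "\<And>r. r \<in> R \<Longrightarrow> ncpoly_subst f r \<in> Idl\<^bsub>free_algebra T\<^esub> R'"
  shows "\<exists>\<phi>. algebra_hom (presented_algebra S R) (presented_algebra T R') \<phi> \<and>
    (\<forall>p \<in> carrier (free_algebra S). \<phi> ((Idl\<^bsub>free_algebra S\<^esub> R) +>\<^bsub>free_algebra S\<^esub> p) =
        (Idl\<^bsub>free_algebra T\<^esub> R') +>\<^bsub>free_algebra T\<^esub> ncpoly_subst f p)"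
proof -
  let ?F = "free_algebra S" and ?F' = "free_algebra T"
  let ?I = "Idl\<^bsub>?F\<^esub> R" and ?J = "Idl\<^bsub>?F'\<^esub> R'"
  let ?h = "\<lambda>p. ?J +>\<^bsub>?F'\<^esub> ncpoly_subst f p"
  note A = presented_algebra_simps[OF R] and B = presented_algebra_simps[OF R']
  note cl = ncpoly_subst_closed[of S f T, OF f]
  interpret J: ideal ?J ?F' by (rule B(1))
  interpret F: ring ?F by (rule ring_free_algebra)
  have "ideal {p \<in> carrier ?F. ncpoly_subst f p \<in> ?J} ?F"
  proof (rule ring_hom_ring.ideal_vimage[OF _ B(1)])
    show "ring_hom_ring ?F ?F' (ncpoly_subst f)"
      by (intro ring_hom_ringI2 ring_free_algebra ring_hom_memI)
         (auto simp: cl ncpoly_subst_simps free_algebra_simps(2-))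
  qed
  then have I: "ncpoly_subst f p \<in> ?J" if "p \<in> ?I" for p
    using F.genideal_minimal[of _ R] rel R that by blast
  define \<phi> where "\<phi> = (\<lambda>C. ?h (SOME p. p \<in> carrier ?F \<and> C = ?I +>\<^bsub>?F\<^esub> p))"
  have \<phi>: "\<phi> (?I +>\<^bsub>?F\<^esub> p) = ?h p" if p: "p \<in> carrier ?F" for p
  proof -
    define q where "q = (SOME q. q \<in> carrier ?F \<and> ?I +>\<^bsub>?F\<^esub> p = ?I +>\<^bsub>?F\<^esub> q)"
    have "q \<in> carrier ?F \<and> ?I +>\<^bsub>?F\<^esub> p = ?I +>\<^bsub>?F\<^esub> q"
      unfolding q_def by (rule someI[of _ p]) (use p in auto)
    then have q: "q \<in> carrier ?F" "q - p \<in> ?I" using A(6)[of q p] p by auto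
    then have "?h q = ?h p"
      using I[of "q - p"] B(6)[of "ncpoly_subst f q" "ncpoly_subst f p"] p cl by (simp add: ncpoly_subst_diff)
    then show ?thesis by (simp add: \<phi>_def q_def)
  qed
  have "algebra_hom (presented_algebra S R) (presented_algebra T R') \<phi>"
    unfolding algebra_hom_def
  proof (intro conjI ring_hom_memI allI ballI)
  qed (auto simp: A(5,7-) B(5,7-) \<phi> cl free_algebra_closed ncpoly_subst_simps)
  with \<phi> show ?thesis by blast
qed

lemma presented_algebra_hom_unique:
  assumes R: "R \<subseteq> carrier (free_algebra S)" and B: "ring B"
    and hom: "algebra_hom (presented_algebra S R) B \<phi>" "algebra_hom (presented_algebra S R) B \<psi>"
    and eq: "\<And>x. x \<in> S \<Longrightarrow> \<phi> (presented_gen S R x) = \<psi> (presented_gen S R x)"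
    and a: "a \<in> carrier (presented_algebra S R)"
  shows "\<phi> a = \<psi> a"
proof -
  let ?F = "free_algebra S" and ?A = "presented_algebra S R"
  let ?I = "Idl\<^bsub>?F\<^esub> R"
  note A = presented_algebra_simps[OF R]
  have h: "\<phi> \<in> ring_hom ?A B" "\<psi> \<in> ring_hom ?A B" using hom by (auto simp: algebra_hom_def)
  have "\<phi> (?I +>\<^bsub>?F\<^esub> p) = \<psi> (?I +>\<^bsub>?F\<^esub> p)" if "p \<in> carrier ?F" for p
    using that
  proof (induction rule: free_algebra_induct)
    case (scalar c)
    have "?I +>\<^bsub>?F\<^esub> scalar c = c \<odot>\<^bsub>?A\<^esub> \<one>\<^bsub>?A\<^esub>"
      using A(11)[of 1 c] by (simp add: A(9) free_algebra_closed)
    moreover have "\<one>\<^bsub>?A\<^esub> \<in> carrier ?A" using A(3) by (simp add: ring.ring_simprules)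
    ultimately show ?case using hom ring_hom_one[OF h(1)] ring_hom_one[OF h(2)]
      by (simp add: algebra_hom_def)
  next
    case (gen x)
    then show ?case using eq by (simp add: presented_gen_def)
  next
    case (add p q)
    then show ?case using ring_hom_add[OF h(1), of "?I +>\<^bsub>?F\<^esub> p" "?I +>\<^bsub>?F\<^esub> q"]
      ring_hom_add[OF h(2), of "?I +>\<^bsub>?F\<^esub> p" "?I +>\<^bsub>?F\<^esub> q"] by (simp add: A(5,8))
  next
    case (mult p q)
    then show ?case using ring_hom_mult[OF h(1), of "?I +>\<^bsub>?F\<^esub> p" "?I +>\<^bsub>?F\<^esub> q"]
      ring_hom_mult[OF h(2), of "?I +>\<^bsub>?F\<^esub> p" "?I +>\<^bsub>?F\<^esub> q"] by (simp add: A(5,7))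
  qed
  then show ?thesis using a A(5) by auto
qed


lemma double_jordan_relations_closed:
  "(double_jordan_relations :: (djgen, 'k::field) ncpoly set) \<subseteq> carrier (free_algebra UNIV)"
  by (auto simp: free_algebra_simps)

lemma sl2_closed:
  assumes "a \<in> sl2" "b \<in> sl2"
  shows "a + b \<in> sl2" "matrix_scale c a \<in> sl2" "matrix_bracket a b \<in> sl2"
  using assms
  by (simp add: sl2_def trace_add,
      simp_all add: sl2_def trace_def sum_2 matrix_bracket_def matrix_scale_def
        matrix_matrix_mult_def flip: distrib_left)

lemma sl2_relations_closed: "(sl2_relations :: ('k mat2, 'k::field) ncpoly set) \<subseteq> carrier (free_algebra sl2)"
  unfolding sl2_relations_def enveloping_relations_def
  by (auto intro!: free_algebra_closed sl2_closed)

definition double_jordan_proj_gen :: "djgen \<Rightarrow> ('k mat2, 'k::field) ncpoly" where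
  "double_jordan_proj_gen t = (case t of
      Gen_u \<Rightarrow> 0 | Gen_v \<Rightarrow> scalar (1 / 4) * gen sl2_e | Gen_zeta \<Rightarrow> scalar (- 1 / 2) * gen sl2_h
    | Gen_g \<Rightarrow> 1 | Gen_ginv \<Rightarrow> 1 | Gen_x \<Rightarrow> 0 | Gen_y \<Rightarrow> scalar 2 * gen sl2_f)"

lemma double_jordan_proj_relations:
  fixes r :: "(djgen, 'k::field_char_0) ncpoly"
  assumes "r \<in> double_jordan_relations"
  shows "ncpoly_subst double_jordan_proj_gen r \<in> Idl\<^bsub>free_algebra sl2\<^esub> sl2_relations"
proof -
  let ?F = "free_algebra sl2 :: ('k mat2, 'k) ncpoly ring"
  let ?J = "Idl\<^bsub>?F\<^esub> sl2_relations"
  note J = presented_algebra_simps[OF sl2_relations_closed[where 'k = 'k]]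
  interpret J: ideal ?J ?F by (rule J(1))
  note ch = sl2_chevalley[where 'k = 'k]
  let ?e = "gen sl2_e :: ('k mat2, 'k) ncpoly" and ?f = "gen sl2_f" and ?h = "gen sl2_h"
  have scal: "scalar c * p \<in> ?J" if "p \<in> ?J" for c p
    using J.I_l_closed[OF that, of "scalar c"] by (simp add: free_algebra_simps(2-) free_algebra_closed)
  have add: "p + q \<in> ?J" if "p \<in> ?J" "q \<in> ?J" for p q
    using additive_subgroup.a_closed[OF ideal.axioms(1)[OF J(1)] that] by (simp add: free_algebra_simps(2-))
  have zero: "0 \<in> ?J"
    using additive_subgroup.zero_closed[OF ideal.axioms(1)[OF J(1)]] by (simp add: free_algebra_simps(2-))
  have br: "gen a * gen b - gen b * gen a - gen (matrix_bracket a b) \<in> ?J" if "a \<in> sl2" "b \<in> sl2" for a b :: "'k mat2"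
    by (rule subsetD[OF J(2)]) (use that in \<open>auto simp: sl2_relations_def enveloping_relations_def\<close>)
  have sc: "gen (matrix_scale c a) - scalar c * gen a \<in> ?J" if "a \<in> sl2" for a :: "'k mat2" and c
    by (rule subsetD[OF J(2)]) (use that in \<open>auto simp: sl2_relations_def enveloping_relations_def\<close>)
  have ef: "?e * ?f - ?f * ?e - ?h \<in> ?J"
    using br[of sl2_e sl2_f] ch by simp
  have he: "?h * ?e - ?e * ?h - scalar 2 * ?e \<in> ?J"
    using add[OF br[of sl2_h sl2_e] sc[of sl2_e 2]] ch by simp
  have hf: "?h * ?f - ?f * ?h - scalar (- 2) * ?f \<in> ?J"
    using add[OF br[of sl2_h sl2_f] sc[of sl2_f "- 2"]] ch by simp
  have swap: "scalar c * p * (scalar d * q) = scalar (c * d) * (p * q)" for c d and p q :: "('k mat2, 'k) ncpoly"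
    by (simp add: mult.assoc scalar_left_commute[of p d] scalar_simps(4))
  have sub: "scalar c * (p - q) = scalar c * p - scalar c * q" "scalar c * (scalar d * p) = scalar (c * d) * p"
    for c d and p q :: "('k mat2, 'k) ncpoly"
    by (simp_all add: right_diff_distrib scalar_simps(4) mult.assoc)
  have r1: "scalar (- 1 / 2) * ?h * (scalar 2 * ?f) -
      (scalar 2 * ?f * (scalar (- 1 / 2) * ?h) + scalar 2 * ?f) \<in> ?J"
    using scal[OF hf, of "- 1"] unfolding swap sub by (simp add: algebra_simps)
  have r2: "scalar (1 / 4) * ?e * (scalar (- 1 / 2) * ?h) -
      (scalar (- 1 / 2) * ?h * (scalar (1 / 4) * ?e) + scalar (1 / 4) * ?e) \<in> ?J"
    using scal[OF he, of "1 / 8"] unfolding swap sub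
    by (simp add: scalar_simps(5) algebra_simps flip: minus_divide_left)
  have r3: "scalar (1 / 4) * ?e * (scalar 2 * ?f) -
      (scalar 2 * ?f * (scalar (1 / 4) * ?e) - scalar (- 1 / 2) * ?h) \<in> ?J"
    using scal[OF ef, of "1 / 2"] unfolding swap sub
    by (simp add: scalar_simps(5) algebra_simps flip: minus_divide_left)
  show ?thesis
    using assms zero r1 r2 r3 unfolding double_jordan_relations_def Let_def
    by (auto simp: ncpoly_subst_simps double_jordan_proj_gen_def power2_eq_square)
qed

theorem double_jordan_proj_ex1:
  "\<exists>!\<pi>. \<pi> \<in> extensional (carrier double_jordan) \<and>
     is_double_jordan_proj (\<pi> :: (djgen, 'k::field_char_0) ncpoly set \<Rightarrow> _)"
proof -
  let ?F = "free_algebra UNIV :: (djgen, 'k) ncpoly ring"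
  let ?F' = "free_algebra sl2 :: ('k mat2, 'k) ncpoly ring"
  let ?I = "Idl\<^bsub>?F\<^esub> double_jordan_relations" and ?J = "Idl\<^bsub>?F'\<^esub> sl2_relations"
  let ?D = "double_jordan :: ('k, _) module" and ?U = "U_sl2 :: ('k, _) module"
  note A = presented_algebra_simps[OF double_jordan_relations_closed[where 'k = 'k], folded double_jordan_def]
  note B = presented_algebra_simps[OF sl2_relations_closed[where 'k = 'k], folded U_sl2_def]
  note ch = sl2_chevalley[where 'k = 'k]
  interpret D: ring ?D by (rule A(3))
  interpret U: ring ?U by (rule B(3))
  have genD: "double_jordan_gen t \<in> carrier ?D" for t
    by (auto simp: double_jordan_gen_def presented_gen_def A(5) free_algebra_closed)
  have cl: "double_jordan_proj_gen t \<in> carrier ?F'" for t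
    using ch by (auto simp: double_jordan_proj_gen_def free_algebra_closed split: djgen.split)
  obtain \<phi> where \<phi>: "algebra_hom ?D ?U \<phi>"
    "\<And>p. \<phi> (?I +>\<^bsub>?F\<^esub> p) = ?J +>\<^bsub>?F'\<^esub> ncpoly_subst double_jordan_proj_gen p"
    using presented_algebra_hom_exists[OF double_jordan_relations_closed sl2_relations_closed
        cl double_jordan_proj_relations]
    by (auto simp: double_jordan_def U_sl2_def free_algebra_simps)
  have gen: "\<phi> (double_jordan_gen t) = ?J +>\<^bsub>?F'\<^esub> double_jordan_proj_gen t" for t
    by (simp add: double_jordan_gen_def presented_gen_def \<phi>(2))
  have smult_closed: "c \<odot>\<^bsub>?D\<^esub> a \<in> carrier ?D" if "a \<in> carrier ?D" for c a
    using that by (auto simp: A(5,11) free_algebra_closed)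
  have g: "\<pi> (double_jordan_gen Gen_g \<ominus>\<^bsub>?D\<^esub> \<one>\<^bsub>?D\<^esub>) = \<pi> (double_jordan_gen Gen_g) \<ominus>\<^bsub>?U\<^esub> \<one>\<^bsub>?U\<^esub>"
    if "algebra_hom ?D ?U \<pi>" for \<pi>
  proof -
    interpret h: ring_hom_ring ?D ?U \<pi>
      using that by (intro ring_hom_ringI2 A(3) B(3)) (simp add: algebra_hom_def)
    show ?thesis by (simp add: a_minus_def genD)
  qed
  have ginv: "\<pi> (double_jordan_gen Gen_ginv) = \<one>\<^bsub>?U\<^esub>"
    if "algebra_hom ?D ?U \<pi>" "\<pi> (double_jordan_gen Gen_g) = \<one>\<^bsub>?U\<^esub>" for \<pi>
  proof -
    interpret h: ring_hom_ring ?D ?U \<pi>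
      using that by (intro ring_hom_ringI2 A(3) B(3)) (simp add: algebra_hom_def)
    have "gen Gen_g * gen Gen_ginv - 1 \<in> ?I"
      by (rule subsetD[OF A(2)]) (simp add: double_jordan_relations_def Let_def)
    then have "double_jordan_gen Gen_g \<otimes>\<^bsub>?D\<^esub> double_jordan_gen Gen_ginv = \<one>\<^bsub>?D\<^esub>"
      by (simp add: double_jordan_gen_def presented_gen_def A(6,7,9) free_algebra_closed)
    then have "\<pi> (double_jordan_gen Gen_g) \<otimes>\<^bsub>?U\<^esub> \<pi> (double_jordan_gen Gen_ginv) = \<one>\<^bsub>?U\<^esub>"
      using genD by (metis h.hom_mult h.hom_one)
    then show ?thesis using that(2) genD[of Gen_ginv] by simp
  qed
  have inU: "U_sl2_incl a = ?J +>\<^bsub>?F'\<^esub> gen a" for a :: "'k mat2"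
    by (simp add: U_sl2_incl_def presented_gen_def)
  let ?\<pi> = "restrict \<phi> (carrier ?D)"
  have "algebra_hom ?D ?U ?\<pi>"
    using \<phi>(1) smult_closed unfolding algebra_hom_def ring_hom_def by auto
  then have ex: "is_double_jordan_proj ?\<pi>"
    using ch g[of ?\<pi>] genD U.r_neg[OF U.one_closed]
    by (simp add: is_double_jordan_proj_def gen double_jordan_proj_gen_def inU B(9-11) free_algebra_closed
        a_minus_def)
  have uniq: "\<pi> = \<pi>'" if "\<pi> \<in> extensional (carrier ?D)" "\<pi>' \<in> extensional (carrier ?D)"
    "is_double_jordan_proj \<pi>" "is_double_jordan_proj \<pi>'" for \<pi> \<pi>'
  proof (rule extensionalityI[OF that(1,2)])
    have h: "algebra_hom ?D ?U \<pi>" "algebra_hom ?D ?U \<pi>'"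
      using that by (simp_all add: is_double_jordan_proj_def)
    have one: "\<rho> (double_jordan_gen Gen_g) = \<one>\<^bsub>?U\<^esub>" if "is_double_jordan_proj \<rho>" for \<rho>
    proof -
      have \<rho>: "algebra_hom ?D ?U \<rho>" using that by (simp add: is_double_jordan_proj_def)
      then have "\<rho> (double_jordan_gen Gen_g) \<in> carrier ?U"
        using genD by (auto simp: algebra_hom_def ring_hom_closed)
      moreover have "\<rho> (double_jordan_gen Gen_g) \<ominus>\<^bsub>?U\<^esub> \<one>\<^bsub>?U\<^esub> = \<zero>\<^bsub>?U\<^esub>"
        using that g[OF \<rho>] by (simp add: is_double_jordan_proj_def)
      ultimately show ?thesis by simp
    qed
    have "\<pi> (double_jordan_gen t) = \<pi>' (double_jordan_gen t)" for t
      using that(3,4) one[OF that(3)] one[OF that(4)] ginv[OF h(1)] ginv[OF h(2)]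
      by (cases t) (simp_all add: is_double_jordan_proj_def)
    then show "\<pi> a = \<pi>' a" if "a \<in> carrier ?D" for a
      using presented_algebra_hom_unique[OF double_jordan_relations_closed B(3), of \<pi> \<pi>' a] h that
      by (simp add: double_jordan_def double_jordan_gen_def)
  qed
  show ?thesis
    using ex uniq by (intro ex1I[of _ ?\<pi>]) auto
qed

corollary double_jordan_proj:
  "is_double_jordan_proj (double_jordan_proj :: (djgen, 'k::field_char_0) ncpoly set \<Rightarrow> _)"
  using theI'[OF double_jordan_proj_ex1[where 'k = 'k]] unfolding double_jordan_proj_def by blast

end

theory Submission
  imports Defs
begin

text \<open>
  As \<open>\<pi>\<close> is surjective, the point is that its kernel annihilates every finite-dimensional simple
  module \<open>M\<close> over the double of the Jordan plane.  Since \<open>[\<zeta>, x] = x\<close> and \<open>[\<zeta>, u] = - u\<close>, both \<open>x\<close>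
  and \<open>u\<close> act nilpotently.  Together with \<open>[u\<^sup>n, y] = n u\<^sup>n\<^sup>-\<^sup>1 (1 - g)\<close> this produces a nonzero vector
  killed by \<open>x\<close>, \<open>u\<close> and \<open>1 - g\<close>.  By the defining relations the common kernel of these three elements
  is a submodule, hence all of \<open>M\<close>.  On such a module \<open>4 v\<close>, \<open>y / 2\<close> and \<open>- 2 \<zeta>\<close> satisfy the
  relations of \<open>e\<close>, \<open>f\<close> and \<open>h\<close>, so the action factors through \<open>\<pi>\<close>.
\<close>

(* otherwise matrix entries a $ i $ j parse ambiguously *)
no_notation fps_nth (infixl \<open>$\<close> 75)

section \<open>Restriction of scalars along a surjection\<close>

lemma module_iso_refl: "module_iso A M M"
  unfolding module_iso_def by (rule exI[of _ id]) auto

text \<open>The module axioms of \<open>M\<close> keep sums and multiples of preimages inside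
  \<open>carrier M\<close>, where injectivity of \<open>\<phi>\<close> identifies them as the values
  of the inverse map.\<close>

lemma module_iso_sym:
  assumes M: "left_module A M" and iso: "module_iso A M N"
  shows "module_iso A N M"
proof -
  interpret M: left_module A M by (rule M)
  from iso obtain \<phi> where bij: "bij_betw \<phi> (carrier M) (carrier N)"
    and add: "\<And>m m'. \<lbrakk>m \<in> carrier M; m' \<in> carrier M\<rbrakk> \<Longrightarrow> \<phi> (m \<oplus>\<^bsub>M\<^esub> m') = \<phi> m \<oplus>\<^bsub>N\<^esub> \<phi> m'"
    and smult: "\<And>a m. \<lbrakk>a \<in> carrier A; m \<in> carrier M\<rbrakk> \<Longrightarrow> \<phi> (a \<odot>\<^bsub>M\<^esub> m) = a \<odot>\<^bsub>N\<^esub> \<phi> m"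
    unfolding module_iso_def by blast
  define \<psi> where "\<psi> = the_inv_into (carrier M) \<phi>"
  have inj: "inj_on \<phi> (carrier M)" using bij by (rule bij_betw_imp_inj_on)
  have \<psi>: "\<psi> n \<in> carrier M" "\<phi> (\<psi> n) = n" if "n \<in> carrier N" for n
    using that bij bij_betw_the_inv_into[OF bij] f_the_inv_into_f_bij_betw[OF bij]
    by (auto simp: \<psi>_def bij_betw_apply)
  have \<psi>_eqI: "\<psi> n = m" if "m \<in> carrier M" "\<phi> m = n" for m n
    using that inj by (auto simp: \<psi>_def the_inv_into_f_f)
  have "bij_betw \<psi> (carrier N) (carrier M)"
    unfolding \<psi>_def by (rule bij_betw_the_inv_into[OF bij])
  moreover have "\<psi> (n \<oplus>\<^bsub>N\<^esub> n') = \<psi> n \<oplus>\<^bsub>M\<^esub> \<psi> n'" if "n \<in> carrier N" "n' \<in> carrier N" for n n'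
    by (rule \<psi>_eqI) (use that \<psi> add in auto)
  moreover have "\<psi> (a \<odot>\<^bsub>N\<^esub> n) = a \<odot>\<^bsub>M\<^esub> \<psi> n" if "a \<in> carrier A" "n \<in> carrier N" for a n
    by (rule \<psi>_eqI) (use that \<psi> smult in auto)
  ultimately show ?thesis unfolding module_iso_def by blast
qed

lemma module_iso_trans:
  assumes "module_iso A L M" "module_iso A M N"
  shows "module_iso A L N"
proof -
  from assms(1) obtain \<phi> where \<phi>: "bij_betw \<phi> (carrier L) (carrier M)"
    "\<forall>m \<in> carrier L. \<forall>m' \<in> carrier L. \<phi> (m \<oplus>\<^bsub>L\<^esub> m') = \<phi> m \<oplus>\<^bsub>M\<^esub> \<phi> m'"
    "\<forall>a \<in> carrier A. \<forall>m \<in> carrier L. \<phi> (a \<odot>\<^bsub>L\<^esub> m) = a \<odot>\<^bsub>M\<^esub> \<phi> m"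
    unfolding module_iso_def by blast
  from assms(2) obtain \<psi> where \<psi>: "bij_betw \<psi> (carrier M) (carrier N)"
    "\<forall>m \<in> carrier M. \<forall>m' \<in> carrier M. \<psi> (m \<oplus>\<^bsub>M\<^esub> m') = \<psi> m \<oplus>\<^bsub>N\<^esub> \<psi> m'"
    "\<forall>a \<in> carrier A. \<forall>m \<in> carrier M. \<psi> (a \<odot>\<^bsub>M\<^esub> m) = a \<odot>\<^bsub>N\<^esub> \<psi> m"
    unfolding module_iso_def by blast
  show ?thesis
    unfolding module_iso_def
    by (rule exI[of _ "\<psi> \<circ> \<phi>"])
       (use \<phi> \<psi> bij_betw_apply[OF \<phi>(1)] in \<open>auto intro: bij_betw_trans\<close>)
qed

lemma iso_class_eq_iff:
  assumes "left_module A M" "left_module A N"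
  shows "iso_class A M = iso_class A N \<longleftrightarrow> module_iso A M N"
proof
  assume "iso_class A M = iso_class A N"
  then have "M \<in> iso_class A N"
    using assms module_iso_refl by (auto simp: iso_class_def)
  then show "module_iso A M N"
    using assms module_iso_sym by (auto simp: iso_class_def)
next
  assume "module_iso A M N"
  then show "iso_class A M = iso_class A N"
    using assms module_iso_sym module_iso_trans unfolding iso_class_def by blast
qed

text \<open>
  In the next locale \<open>M\<close> is, up to the values of the action outside the carrier of \<open>A\<close>, the
  module obtained from \<open>L\<close> by restriction of scalars along \<open>\<phi>\<close>.
\<close>

locale surjective_restriction =
  fixes A :: "('k, 'a) module" and B :: "('k, 'b) module" and \<phi> :: "'a \<Rightarrow> 'b"
    and M :: "('a, 'm) module" and L :: "('b, 'm) module"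
  assumes A: "ring A" and B: "ring B" and hom: "algebra_hom A B \<phi>"
    and surj: "\<phi> ` carrier A = carrier B"
    and carrier_eq: "carrier M = carrier L" and add_eq: "add M = add L" and zero_eq: "zero M = zero L"
    and smult_eq: "\<lbrakk>a \<in> carrier A; m \<in> carrier L\<rbrakk> \<Longrightarrow> a \<odot>\<^bsub>M\<^esub> m = \<phi> a \<odot>\<^bsub>L\<^esub> m"
begin

lemma ring_hom: "\<phi> \<in> ring_hom A B"
  using hom by (simp add: algebra_hom_def)

lemma surjE:
  assumes "b \<in> carrier B"
  obtains a where "a \<in> carrier A" "b = \<phi> a"
  using assms unfolding surj[symmetric] by (rule imageE)

lemma abelian_group_iff: "abelian_group M \<longleftrightarrow> abelian_group L"
proof -
  \<comment> \<open>The records \<open>M\<close> and \<open>L\<close> have different types, so the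
    axioms are transferred component by component; arbitrary \<open>N\<close> and \<open>N'\<close>
    cover both directions at once.\<close>
  have "abelian_group N'"
    if N: "abelian_group N" and eq: "carrier N' = carrier N" "add N' = add N" "zero N' = zero N"
    for N :: "('m, 'c) ring_scheme" and N' :: "('m, 'd) ring_scheme"
  proof -
    interpret N: abelian_group N by (rule N)
    show ?thesis
      by (rule abelian_groupI, unfold eq)
         (auto intro: N.a_assoc N.a_comm bexI[of _ "\<ominus>\<^bsub>N\<^esub> x" for x] N.l_neg)
  qed
  then show ?thesis
    using carrier_eq add_eq zero_eq by metis
qed

text \<open>From \<open>L\<close> to \<open>M\<close> the axioms pull back along
  \<open>\<phi>\<close>. Conversely, surjectivity writes each scalar of \<open>B\<close> as some
  \<open>\<phi> a\<close>, whose action on \<open>L\<close> is that of \<open>a\<close> on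
  \<open>M\<close>.\<close>

lemma left_module_iff: "left_module A M \<longleftrightarrow> left_module B L"
proof
  interpret A: ring A by (rule A)
  interpret B: ring B by (rule B)
  note [simp] = ring_hom_add[OF ring_hom] ring_hom_mult[OF ring_hom] ring_hom_one[OF ring_hom]
  note [simp] = ring_hom_closed[OF ring_hom] carrier_eq add_eq smult_eq
  {
    assume "left_module B L"
    then interpret L: left_module B L .
    show "left_module A M"
    proof (intro left_module.intro left_module_axioms.intro A)
      show "abelian_group M" using L.abelian_group_axioms by (simp add: abelian_group_iff)
    qed (simp_all add: L.smult_l_distr L.smult_r_distr L.smult_assoc1)
  next
    assume "left_module A M"
    then interpret M: left_module A M .
    have closed: "\<phi> a \<odot>\<^bsub>L\<^esub> m \<in> carrier L" if "a \<in> carrier A" "m \<in> carrier L" for a m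
      using M.smult_closed[of a m] that by simp
    show "left_module B L"
    proof (intro left_module.intro left_module_axioms.intro B)
      show "abelian_group L" using M.abelian_group_axioms by (simp add: abelian_group_iff)
    next
      fix b m assume "b \<in> carrier B" "m \<in> carrier L"
      then show "b \<odot>\<^bsub>L\<^esub> m \<in> carrier L"
        by (auto elim!: surjE intro: closed)
    next
      fix b b' m assume "b \<in> carrier B" "b' \<in> carrier B" and m: "m \<in> carrier L"
      then obtain a a' where a: "a \<in> carrier A" "b = \<phi> a" "a' \<in> carrier A" "b' = \<phi> a'"
        by (auto elim!: surjE)
      show "(b \<oplus>\<^bsub>B\<^esub> b') \<odot>\<^bsub>L\<^esub> m = b \<odot>\<^bsub>L\<^esub> m \<oplus>\<^bsub>L\<^esub> b' \<odot>\<^bsub>L\<^esub> m"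
        using M.smult_l_distr[of a a' m] a m by simp
      show "(b \<otimes>\<^bsub>B\<^esub> b') \<odot>\<^bsub>L\<^esub> m = b \<odot>\<^bsub>L\<^esub> (b' \<odot>\<^bsub>L\<^esub> m)"
        using M.smult_assoc1[of a a' m] a m closed by simp
    next
      fix b m n assume b: "b \<in> carrier B" and m: "m \<in> carrier L" "n \<in> carrier L"
      from b obtain a where a: "a \<in> carrier A" "b = \<phi> a"
        by (rule surjE)
      have "m \<oplus>\<^bsub>L\<^esub> n \<in> carrier L" using M.a_closed[of m n] m by simp
      then show "b \<odot>\<^bsub>L\<^esub> (m \<oplus>\<^bsub>L\<^esub> n) = b \<odot>\<^bsub>L\<^esub> m \<oplus>\<^bsub>L\<^esub> b \<odot>\<^bsub>L\<^esub> n"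
        using M.smult_r_distr[of a m n] a m by simp
    next
      fix m assume "m \<in> carrier L"
      then show "\<one>\<^bsub>B\<^esub> \<odot>\<^bsub>L\<^esub> m = m"
        using M.smult_one[of m] smult_eq[OF A.one_closed, of m] by simp
    qed
  }
qed

text \<open>The additive structures agree, and by surjectivity stability under all
  \<open>\<phi> a\<close> with \<open>a \<in> carrier A\<close> is stability under
  \<open>carrier B\<close>.\<close>

lemma submodule_iff: "submodule N A M \<longleftrightarrow> submodule N B L"
proof -
  have "m_inv (add_monoid M) m = m_inv (add_monoid L) m" for m
    by (simp add: m_inv_def carrier_eq add_eq zero_eq)
  then have "subgroup N (add_monoid M) \<longleftrightarrow> subgroup N (add_monoid L)"
    unfolding subgroup_def by (simp add: carrier_eq add_eq zero_eq)
  moreover have "submodule_axioms N A M \<longleftrightarrow> submodule_axioms N B L" if "N \<subseteq> carrier L"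
  proof -
    have "submodule_axioms N B L \<longleftrightarrow> (\<forall>a \<in> carrier A. \<forall>m \<in> N. \<phi> a \<odot>\<^bsub>L\<^esub> m \<in> N)"
      unfolding submodule_axioms_def by (auto simp flip: surj)
    also have "\<dots> \<longleftrightarrow> submodule_axioms N A M"
      unfolding submodule_axioms_def using that by (auto simp: subset_eq smult_eq)
    finally show ?thesis by (rule sym)
  qed
  moreover have "N \<subseteq> carrier L" if "subgroup N (add_monoid L)"
    using subgroup.subset[OF that] by simp
  ultimately show ?thesis
    unfolding submodule_def by blast
qed

lemma simple_module_iff: "simple_module A M \<longleftrightarrow> simple_module B L"
  unfolding simple_module_def by (simp add: left_module_iff submodule_iff carrier_eq zero_eq)

text \<open>A homomorphism of algebras sends \<open>c \<cdot> 1\<close> to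
  \<open>c \<cdot> 1\<close>. Being a ring does not put this element in the carrier, while
  \<open>smult_eq\<close> concerns only the carrier; hence the first hypothesis.\<close>

lemma base_smult_eq:
  assumes "c \<odot>\<^bsub>A\<^esub> \<one>\<^bsub>A\<^esub> \<in> carrier A" "m \<in> carrier L"
  shows "base_smult A M c m = base_smult B L c m"
  using assms hom ring_hom_one[OF ring_hom] ring.ring_simprules(6)[OF A]
  by (simp add: base_smult_def smult_eq algebra_hom_def)

lemma finsum_eq:
  assumes L: "abelian_group L" and fin: "finite S" and f: "f \<in> S \<rightarrow> carrier L"
  shows "finsum M f S = finsum L f S"
proof -
  interpret L: abelian_group L by (rule L)
  interpret M: abelian_group M using L by (simp add: abelian_group_iff)
  show ?thesis
    using fin f
    by (induction S rule: finite_induct) (simp_all add: carrier_eq add_eq zero_eq Pi_iff)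
qed

text \<open>The same finite set spans both modules, since the base field acts identically on
  them.\<close>

lemma fd_simple_module_iff:
  assumes A_smult: "\<And>c. c \<odot>\<^bsub>A\<^esub> \<one>\<^bsub>A\<^esub> \<in> carrier A"
  shows "fd_simple_module A M \<longleftrightarrow> fd_simple_module B L"
proof -
  have "finite_dimensional_module A M \<longleftrightarrow> finite_dimensional_module B L" if "left_module A M"
  proof -
    interpret M: left_module A M by (rule that)
    interpret L: abelian_group L using M.abelian_group_axioms by (simp add: abelian_group_iff)
    have closed: "base_smult A M c m \<in> carrier L" if "m \<in> carrier L" for c m
      using M.smult_closed[OF A_smult, of m] that by (simp add: base_smult_def carrier_eq)
    then have closed': "base_smult B L c m \<in> carrier L" if "m \<in> carrier L" for c m
      using that base_smult_eq[OF A_smult] by metis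
    have "finsum M (\<lambda>b. base_smult A M (c b) b) S = finsum L (\<lambda>b. base_smult B L (c b) b) S"
      if S: "finite S" "S \<subseteq> carrier L" for S c
    proof -
      have "finsum M (\<lambda>b. base_smult A M (c b) b) S = finsum L (\<lambda>b. base_smult A M (c b) b) S"
        using S closed by (intro finsum_eq L.abelian_group_axioms) auto
      also have "\<dots> = finsum L (\<lambda>b. base_smult B L (c b) b) S"
        using S A_smult by (intro L.finsum_cong') (auto simp: closed' base_smult_eq)
      finally show ?thesis .
    qed
    then show ?thesis
      unfolding finite_dimensional_module_def carrier_eq by (intro ex_cong1 conj_cong refl) simp
  qed
  then show ?thesis
    unfolding fd_simple_module_def using simple_module_iff by (auto simp: simple_module_def)
qed

end

section \<open>Restriction of scalars on isomorphism classes\<close>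

lemma surjective_restriction_restrict_scalars:
  assumes "ring A" "ring B" "algebra_hom A B \<phi>" "\<phi> ` carrier A = carrier B"
  shows "surjective_restriction A B \<phi> (restrict_scalars \<phi> L) L"
  using assms by (intro surjective_restriction.intro) (simp_all add: restrict_scalars_def)

text \<open>A map compatible with the action of every \<open>\<phi> a\<close> is compatible with all
  of \<open>carrier B\<close>, so restriction creates no new isomorphisms.\<close>

lemma module_iso_restrict_scalars_iff:
  assumes "\<phi> ` carrier A = carrier B"
  shows "module_iso A (restrict_scalars \<phi> L) (restrict_scalars \<phi> L') \<longleftrightarrow> module_iso B L L'"
  unfolding module_iso_def restrict_scalars_def by (simp flip: assms)

text \<open>Injectivity holds because modules that become isomorphic after restriction were
  isomorphic before. For surjectivity, \<open>ker\<close> says that on a finite-dimensional simple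
  module the action of \<open>a\<close> depends only on \<open>\<phi> a\<close>, so the module
  descends to \<open>B\<close>.\<close>

proposition irrep_bij_betw_restrict_scalars:
  fixes A :: "('k, 'a) module" and B :: "('k, 'b) module"
  assumes A: "ring A" and B: "ring B" and hom: "algebra_hom A B \<phi>"
    and surj: "\<phi> ` carrier A = carrier B"
    and A_smult: "\<And>c. c \<odot>\<^bsub>A\<^esub> \<one>\<^bsub>A\<^esub> \<in> carrier A"
    and ker: "\<And>(M :: ('a, 'm) module) a a' m. \<lbrakk>fd_simple_module A M; a \<in> carrier A; a' \<in> carrier A;
        \<phi> a = \<phi> a'; m \<in> carrier M\<rbrakk> \<Longrightarrow> a \<odot>\<^bsub>M\<^esub> m = a' \<odot>\<^bsub>M\<^esub> m"
  shows "\<exists>\<Phi> :: ('b, 'm) module set \<Rightarrow> ('a, 'm) module set.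
    (\<forall>L. fd_simple_module B L \<longrightarrow> \<Phi> (iso_class B L) = iso_class A (restrict_scalars \<phi> L)) \<and>
    bij_betw \<Phi> (irrep B) (irrep A)"
proof -
  let ?r = "restrict_scalars \<phi> :: ('b, 'm) module \<Rightarrow> ('a, 'm) module"
  note sr = surjective_restriction_restrict_scalars[OF A B hom surj]
  have fd: "fd_simple_module A (?r L) \<longleftrightarrow> fd_simple_module B L" for L
    by (rule surjective_restriction.fd_simple_module_iff[OF sr A_smult])
  have lm: "left_module B L" "left_module A (?r L)" if "fd_simple_module B L" for L
    using that fd[of L] by (auto simp: fd_simple_module_def simple_module_def)
  have iso: "iso_class A (?r L) = iso_class A (?r L') \<longleftrightarrow> iso_class B L = iso_class B L'"
    if "fd_simple_module B L" "fd_simple_module B L'" for L L'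
    using that lm by (simp add: iso_class_eq_iff module_iso_restrict_scalars_iff[OF surj])
  \<comment> \<open>\<open>\<Phi>\<close> acts on a chosen representative of the class; by
    \<open>iso\<close> the choice is immaterial.\<close>
  define \<Phi> where "\<Phi> C = iso_class A (?r (SOME L. fd_simple_module B L \<and> C = iso_class B L))"
    for C
  have \<Phi>: "\<Phi> (iso_class B L) = iso_class A (?r L)" if L: "fd_simple_module B L" for L
  proof -
    define L' where "L' = (SOME L'. fd_simple_module B L' \<and> iso_class B L = iso_class B L')"
    have "fd_simple_module B L' \<and> iso_class B L = iso_class B L'"
      unfolding L'_def by (rule someI[of _ L]) (use L in auto)
    then show ?thesis
      using iso L unfolding \<Phi>_def L'_def[symmetric] by metis
  qed
  have ess_surj: "\<exists>L. fd_simple_module B L \<and> iso_class A (?r L) = iso_class A M"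
    if M: "fd_simple_module A M" for M :: "('a, 'm) module"
  proof -
    \<comment> \<open>An element \<open>b\<close> acts through a chosen preimage under
      \<open>\<phi>\<close>; by \<open>ker\<close> every preimage in \<open>carrier A\<close> acts
      the same way.\<close>
    define L :: "('b, 'm) module" where
      "L = \<lparr>carrier = carrier M, monoid.mult = monoid.mult M, one = one M, zero = zero M,
        add = add M, module.smult = (\<lambda>b m. inv_into (carrier A) \<phi> b \<odot>\<^bsub>M\<^esub> m)\<rparr>"
    have smult: "a \<odot>\<^bsub>M\<^esub> m = \<phi> a \<odot>\<^bsub>L\<^esub> m" if "a \<in> carrier A" "m \<in> carrier M" for a m
      unfolding L_def
      using ker[OF M that(1) inv_into_into[of "\<phi> a" \<phi> "carrier A"] _ that(2)] that(1)
      by (simp add: f_inv_into_f)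
    have "surjective_restriction A B \<phi> M L"
      using A B hom surj smult by (intro surjective_restriction.intro) (simp_all add: L_def)
    then have L: "fd_simple_module B L"
      using M A_smult by (simp add: surjective_restriction.fd_simple_module_iff)
    \<comment> \<open>The identity gives an isomorphism rather than an equality of records: the two
      actions may differ outside \<open>carrier A\<close>.\<close>
    have "module_iso A M (?r L)"
      unfolding module_iso_def
      by (rule exI[of _ id]) (use smult in \<open>simp add: restrict_scalars_def L_def\<close>)
    moreover have "left_module A M" using M by (simp add: fd_simple_module_def simple_module_def)
    ultimately have "iso_class A (?r L) = iso_class A M"
      using lm(2)[OF L] by (simp add: iso_class_eq_iff[symmetric])
    with L show ?thesis by blast
  qed
  have "bij_betw \<Phi> (irrep B) (irrep A)"
    unfolding bij_betw_def
  proof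
    show "inj_on \<Phi> (irrep B)"
      unfolding irrep_def using \<Phi> iso by (auto intro!: inj_onI)
    show "\<Phi> ` irrep B = irrep A"
    proof (intro equalityI subsetI)
      fix C assume "C \<in> \<Phi> ` irrep B"
      then show "C \<in> irrep A" unfolding irrep_def using \<Phi> fd by blast
    next
      fix C :: "('a, 'm) module set" assume "C \<in> irrep A"
      then obtain M :: "('a, 'm) module" where "fd_simple_module A M" "C = iso_class A M"
        unfolding irrep_def by blast
      then show "C \<in> \<Phi> ` irrep B"
        using ess_surj[of M] \<Phi> unfolding irrep_def by blast
    qed
  qed
  with \<Phi> show ?thesis by blast
qed

section \<open>Actions of noncommutative polynomials\<close>

lemma scalar_diff: "scalar (a - b) = scalar a - scalar b"
  using scalar_simps(3)[of a "- b"] by (simp add: scalar_simps(5))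

text \<open>Gaussian elimination by induction on the equations: a pivot \<open>f j q\<close> removes
  the equation \<open>q\<close> and the unknown \<open>j\<close> together, so the unknowns stay in
  excess.\<close>

lemma homogeneous_system_nontrivial_solution:
  fixes f :: "'i \<Rightarrow> 'p \<Rightarrow> 'k::field"
  assumes "finite P" "finite I" "card P < card I"
  shows "\<exists>c. (\<exists>i\<in>I. c i \<noteq> 0) \<and> (\<forall>p\<in>P. (\<Sum>i\<in>I. c i * f i p) = 0)"
  using assms
proof (induction P arbitrary: I f rule: finite_induct)
  case empty
  then have "I \<noteq> {}" by auto
  then show ?case by (intro exI[of _ "\<lambda>_. 1"]) auto
next
  case (insert q P)
  show ?case
  proof (cases "\<exists>j\<in>I. f j q \<noteq> 0")
    case False
    then show ?thesis using insert by simp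
  next
    case True
    then obtain j where j: "j \<in> I" "f j q \<noteq> 0" by blast
    define g where "g i p = f i p - f i q / f j q * f j p" for i p
    have "\<exists>c. (\<exists>i\<in>I - {j}. c i \<noteq> 0) \<and> (\<forall>p\<in>P. (\<Sum>i\<in>I - {j}. c i * g i p) = 0)"
      using insert.prems insert.hyps j by (intro insert.IH) (auto simp: card_Diff_singleton)
    then obtain c i where c: "i \<in> I - {j}" "c i \<noteq> 0"
      "\<And>p. p \<in> P \<Longrightarrow> (\<Sum>i\<in>I - {j}. c i * g i p) = 0" by blast
    \<comment> \<open>The value at \<open>j\<close> is obtained by solving the equation
      \<open>q\<close>; substituting it into the other equations turns \<open>f\<close> into
      \<open>g\<close>.\<close>
    define d where "d = c(j := - (\<Sum>i\<in>I - {j}. c i * (f i q / f j q)))"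
    have d: "(\<Sum>i\<in>I. d i * f i p) = (\<Sum>i\<in>I - {j}. c i * g i p)" for p
    proof -
      have "(\<Sum>i\<in>I. d i * f i p) = d j * f j p + (\<Sum>i\<in>I - {j}. c i * f i p)"
        using insert.prems(1) j(1) by (subst sum.remove) (auto simp: d_def intro!: sum.cong)
      also have "\<dots> = (\<Sum>i\<in>I - {j}. c i * g i p)"
        by (simp add: d_def g_def algebra_simps sum_subtractf sum_distrib_left sum_distrib_right)
      finally show ?thesis .
    qed
    moreover have "g i q = 0" for i using j by (simp add: g_def)
    ultimately have "\<forall>p\<in>insert q P. (\<Sum>i\<in>I. d i * f i p) = 0"
      using c(3) by simp
    moreover have "\<exists>i\<in>I. d i \<noteq> 0"
      using c by (intro bexI[of _ i]) (auto simp: d_def)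
    ultimately show ?thesis by blast
  qed
qed

text \<open>A module over the free algebra. The constants \<open>scalar c\<close> supply the vector
  space structure, so that no separate scalar multiplication has to be carried along.\<close>

locale ncpoly_action = abelian_group M for M :: "('m, 'r) ring_scheme" (structure) +
  fixes act :: "('x, 'k::field) ncpoly \<Rightarrow> 'm \<Rightarrow> 'm"
  assumes act_closed [simp, intro]: "m \<in> carrier M \<Longrightarrow> act p m \<in> carrier M"
    and act_add_left: "m \<in> carrier M \<Longrightarrow> act (p + q) m = act p m \<oplus> act q m"
    and act_add_right: "\<lbrakk>m \<in> carrier M; n \<in> carrier M\<rbrakk> \<Longrightarrow> act p (m \<oplus> n) = act p m \<oplus> act p n"
    and act_mult: "m \<in> carrier M \<Longrightarrow> act (p * q) m = act p (act q m)"
    and act_1 [simp]: "m \<in> carrier M \<Longrightarrow> act 1 m = m"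
begin

lemma act_0_left [simp]: "m \<in> carrier M \<Longrightarrow> act 0 m = \<zero>"
  using act_add_left[of m 0 0] add.r_cancel_one' by force

lemma act_0_right [simp]: "act p \<zero> = \<zero>"
  using act_add_right[of \<zero> \<zero> p] add.r_cancel_one' by force

lemma act_uminus_left: "m \<in> carrier M \<Longrightarrow> act (- p) m = \<ominus> act p m"
  using act_add_left[of m "- p" p] by (simp add: minus_equality)

lemma act_uminus_right: "m \<in> carrier M \<Longrightarrow> act p (\<ominus> m) = \<ominus> act p m"
  using act_add_right[of "\<ominus> m" m p] by (simp add: l_neg minus_equality)

lemma act_finsum:
  assumes "finite S" "f \<in> S \<rightarrow> carrier M"
  shows "act p (finsum M f S) = (\<Oplus>s\<in>S. act p (f s))"
  using assms by (induction S rule: finite_induct) (auto simp: act_add_right Pi_iff)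

lemma finsum_eq_zero: "(\<And>b. b \<in> B \<Longrightarrow> f b = \<zero>) \<Longrightarrow> finsum M f B = \<zero>"
  using finsum_cong'[of B B "\<lambda>_. \<zero>" f] by simp

text \<open>A two-sided ideal of the free algebra. Equality of operators on \<open>M\<close> is
  expressed as \<open>p - q \<in> annihilator\<close>, so computations with relations stay in the
  free algebra.\<close>

definition annihilator :: "('x, 'k) ncpoly set" where
  "annihilator = {p. \<forall>m\<in>carrier M. act p m = \<zero>}"

lemma annihilator_act: "\<lbrakk>p \<in> annihilator; m \<in> carrier M\<rbrakk> \<Longrightarrow> act p m = \<zero>"
  by (simp add: annihilator_def)

lemma annihilator_0: "0 \<in> annihilator"
  and annihilator_add: "\<lbrakk>p \<in> annihilator; q \<in> annihilator\<rbrakk> \<Longrightarrow> p + q \<in> annihilator"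
  and annihilator_uminus: "p \<in> annihilator \<Longrightarrow> - p \<in> annihilator"
  and annihilator_mult_left: "p \<in> annihilator \<Longrightarrow> r * p \<in> annihilator"
  and annihilator_mult_right: "p \<in> annihilator \<Longrightarrow> p * r \<in> annihilator"
  by (simp_all add: annihilator_def act_add_left act_uminus_left act_mult)

lemma annihilator_diff: "\<lbrakk>p \<in> annihilator; q \<in> annihilator\<rbrakk> \<Longrightarrow> p - q \<in> annihilator"
  using annihilator_add[of p "- q"] annihilator_uminus by simp

lemma annihilator_sum: "(\<And>i. i \<in> I \<Longrightarrow> f i \<in> annihilator) \<Longrightarrow> sum f I \<in> annihilator"
  by (induction I rule: infinite_finite_induct) (auto simp: annihilator_0 annihilator_add)

lemma annihilator_scalarD:
  assumes "scalar c * p \<in> annihilator" "c \<noteq> 0"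
  shows "p \<in> annihilator"
proof -
  have "scalar (1 / c) * (scalar c * p) = p"
    using assms(2) by (simp add: scalar_simps flip: scalar_simps(4) mult.assoc)
  then show ?thesis using annihilator_mult_left[OF assms(1)] by metis
qed

lemma act_cong:
  assumes "p - q \<in> annihilator" "m \<in> carrier M"
  shows "act p m = act q m"
  using act_add_left[of m "p - q" q] annihilator_act[OF assms] assms(2) by simp

lemma annihilator_commute_power:
  assumes "p * q - q * p \<in> annihilator"
  shows "p * q ^ n - q ^ n * p \<in> annihilator"
proof (induction n)
  case 0
  then show ?case by (simp add: annihilator_0)
next
  case (Suc n)
  have "p * q ^ Suc n - q ^ Suc n * p = (p * q - q * p) * q ^ n + q * (p * q ^ n - q ^ n * p)"
    by (simp add: algebra_simps)
  then show ?case using Suc assms by (metis annihilator_add annihilator_mult_left annihilator_mult_right)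
qed

definition finitely_spanned :: bool where
  "finitely_spanned \<longleftrightarrow> (\<exists>B. finite B \<and> B \<subseteq> carrier M \<and>
     (\<forall>m\<in>carrier M. \<exists>c. m = (\<Oplus>b\<in>B. act (scalar (c b)) b)))"

text \<open>With \<open>n\<close> spanning vectors an operator is recorded by \<open>n * n\<close>
  coefficients, so \<open>n * n + 1\<close> powers of \<open>p\<close> are linearly dependent.
  Listing only nonzero coefficients prepares an induction on the number of terms.\<close>

lemma finitely_spanned_polynomial:
  assumes fin: finitely_spanned
  shows "\<exists>I c. finite I \<and> I \<noteq> {} \<and> (\<forall>i\<in>I. c i \<noteq> 0) \<and> (\<Sum>i\<in>I. scalar (c i) * p ^ i) \<in> annihilator"
proof -
  from fin obtain B where B: "finite B" "B \<subseteq> carrier M"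
    and span: "\<And>m. m \<in> carrier M \<Longrightarrow> \<exists>c. m = (\<Oplus>b\<in>B. act (scalar (c b)) b)"
    unfolding finitely_spanned_def by blast
  \<comment> \<open>\<open>B\<close> is only a spanning set, so the coefficients of
    \<open>p ^ i\<close> applied to \<open>b\<close> are chosen; they need not be unique.\<close>
  define a where "a i b = (SOME a. act (p ^ i) b = (\<Oplus>b'\<in>B. act (scalar (a b')) b'))" for i b
  have a: "act (p ^ i) b = (\<Oplus>b'\<in>B. act (scalar (a i b b')) b')" if "b \<in> B" for i b
  proof -
    have "\<exists>a. act (p ^ i) b = (\<Oplus>b'\<in>B. act (scalar (a b')) b')"
      using B that by (intro span) auto
    from someI_ex[OF this] show ?thesis unfolding a_def .
  qed
  \<comment> \<open>The exponents from \<open>0\<close> to \<open>card (B \<times> B)\<close> give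
    one more unknown than there are equations.\<close>
  have "\<exists>c. (\<exists>i\<in>{..card (B \<times> B)}. c i \<noteq> 0) \<and>
      (\<forall>bb\<in>B \<times> B. (\<Sum>i\<le>card (B \<times> B). c i * (case bb of (b, b') \<Rightarrow> a i b b')) = 0)"
    by (rule homogeneous_system_nontrivial_solution) (use B in auto)
  then obtain c where c: "\<exists>i\<in>{..card (B \<times> B)}. c i \<noteq> 0"
    "\<And>b b'. \<lbrakk>b \<in> B; b' \<in> B\<rbrakk> \<Longrightarrow> (\<Sum>i\<le>card (B \<times> B). c i * a i b b') = 0"
    by fastforce
  let ?t = "\<lambda>I. \<Sum>i\<in>I. scalar (c i) * p ^ i"
  have t: "act (?t I) b = (\<Oplus>b'\<in>B. act (scalar (\<Sum>i\<in>I. c i * a i b b')) b')"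
    if "finite I" "b \<in> B" for I b
    using that(1)
  proof (induction I rule: finite_induct)
    case empty
    have "act 0 b = \<zero>" "finsum M (act 0) B = \<zero>"
      using B that by (auto intro!: finsum_eq_zero)
    then show ?case by (simp add: scalar_simps)
  next
    case (insert i I)
    have b: "b \<in> carrier M" using that B by auto
    have "act (scalar (c i) * p ^ i) b = (\<Oplus>b'\<in>B. act (scalar (c i)) (act (scalar (a i b b')) b'))"
      using b B that(2) by (auto simp: act_mult a intro!: act_finsum)
    also have "\<dots> = (\<Oplus>b'\<in>B. act (scalar (c i * a i b b')) b')"
      using B by (intro finsum_cong') (auto simp: scalar_simps(4) act_mult)
    finally have "act (?t (insert i I)) b =
      (\<Oplus>b'\<in>B. act (scalar (c i * a i b b')) b') \<oplus> (\<Oplus>b'\<in>B. act (scalar (\<Sum>i\<in>I. c i * a i b b')) b')"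
      using insert b by (simp add: act_add_left)
    also have "\<dots> = (\<Oplus>b'\<in>B. act (scalar (c i * a i b b')) b' \<oplus> act (scalar (\<Sum>i\<in>I. c i * a i b b')) b')"
      using B by (intro finsum_addf[symmetric]) auto
    also have "\<dots> = (\<Oplus>b'\<in>B. act (scalar (\<Sum>i\<in>insert i I. c i * a i b b')) b')"
      using B insert by (intro finsum_cong') (auto simp: scalar_simps(3) act_add_left)
    finally show ?case .
  qed
  define I where "I = {i \<in> {..card (B \<times> B)}. c i \<noteq> 0}"
  have I: "?t I = ?t {..card (B \<times> B)}"
    unfolding I_def by (rule sum.mono_neutral_left) (auto simp: scalar_simps)
  have tB: "act (?t I) b = \<zero>" if "b \<in> B" for b
  proof -
    have "act (?t I) b = (\<Oplus>b'\<in>B. act (scalar (\<Sum>i\<le>card (B \<times> B). c i * a i b b')) b')"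
      unfolding I using that by (intro t) auto
    also have "\<dots> = \<zero>"
      using B c(2) that by (intro finsum_eq_zero) (auto simp: scalar_simps)
    finally show ?thesis .
  qed
  have "?t I \<in> annihilator"
    unfolding annihilator_def
  proof safe
    \<comment> \<open>Vanishing on \<open>B\<close> is enough, because scalars are central in the
      free algebra.\<close>
    fix m assume "m \<in> carrier M"
    then obtain d where d: "m = (\<Oplus>b\<in>B. act (scalar (d b)) b)" using span by blast
    have "act (?t I) m = (\<Oplus>b\<in>B. act (?t I) (act (scalar (d b)) b))"
      unfolding d using B by (intro act_finsum) auto
    also have "\<dots> = (\<Oplus>b\<in>B. act (scalar (d b)) (act (?t I) b))"
      using B by (intro finsum_cong') (auto simp: scalar_commute simp flip: act_mult)
    also have "\<dots> = \<zero>"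
      by (intro finsum_eq_zero) (simp add: tB)
    finally show "act (?t I) m = \<zero>" .
  qed
  moreover have "finite I" "I \<noteq> {}" "\<forall>i\<in>I. c i \<noteq> 0"
    using c(1) by (auto simp: I_def)
  ultimately show ?thesis by blast
qed

end

locale ncpoly_action_char_0 = ncpoly_action M act
  for M :: "('m, 'r) ring_scheme" (structure)
    and act :: "('x, 'k::field_char_0) ncpoly \<Rightarrow> 'm \<Rightarrow> 'm"

text \<open>
  A shortest relation \<open>\<Sum>i\<in>I. c i * p ^ i = 0\<close> has a single term: for \<open>j \<in> I\<close>, multiplying it
  by \<open>j * e\<close> and subtracting its commutator with \<open>z\<close>, which multiplies \<open>c i\<close> by \<open>i * e\<close>,
  removes the term of \<open>j\<close>.
\<close>

lemma (in ncpoly_action_char_0) eigenvector_nilpotent: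
  assumes fin: finitely_spanned and e: "e \<noteq> 0"
    and comm: "z * p - p * z - scalar e * p \<in> annihilator"
  shows "\<exists>n. p ^ n \<in> annihilator"
proof -
  \<comment> \<open>The commutator with \<open>z\<close> is a derivation, so \<open>p ^ i\<close> is
    an eigenvector with eigenvalue \<open>i * e\<close> modulo the annihilator.\<close>
  have comm_power: "z * p ^ i - p ^ i * z - scalar (of_nat i * e) * p ^ i \<in> annihilator" for i
  proof (induction i)
    case 0
    then show ?case by (simp add: annihilator_0 scalar_simps)
  next
    case (Suc i)
    have "z * p ^ Suc i - p ^ Suc i * z - scalar (of_nat (Suc i) * e) * p ^ Suc i =
      (z * p - p * z - scalar e * p) * p ^ i +
      p * (z * p ^ i - p ^ i * z - scalar (of_nat i * e) * p ^ i)"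
      by (simp add: algebra_simps scalar_simps(3) scalar_left_commute)
    then show ?case using Suc comm by (metis annihilator_add annihilator_mult_left annihilator_mult_right)
  qed
  define rel where "rel I c \<longleftrightarrow> finite I \<and> I \<noteq> {} \<and> (\<forall>i\<in>I. c i \<noteq> 0) \<and>
    (\<Sum>i\<in>I. scalar (c i) * p ^ i) \<in> annihilator" for I and c :: "nat \<Rightarrow> 'k"
  have "\<exists>n. p ^ n \<in> annihilator" if "rel I c" for I c
    using that
  proof (induction "card I" arbitrary: I c rule: less_induct)
    case less
    let ?t = "\<Sum>i\<in>I. scalar (c i) * p ^ i"
    have I: "finite I" "I \<noteq> {}" "\<And>i. i \<in> I \<Longrightarrow> c i \<noteq> 0" and t: "?t \<in> annihilator"
      using less.prems by (auto simp: rel_def)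
    from I(2) obtain j where j: "j \<in> I" by blast
    define d where "d i = c i * ((of_nat j - of_nat i) * e)" for i
    have "scalar (d i) * p ^ i = scalar (of_nat j * e) * (scalar (c i) * p ^ i) -
      (z * (scalar (c i) * p ^ i) - (scalar (c i) * p ^ i) * z) +
      scalar (c i) * (z * p ^ i - p ^ i * z - scalar (of_nat i * e) * p ^ i)" for i
    proof -
      have swap: "z * (scalar c * q) = scalar c * (z * q)" "scalar c * (scalar d * q) = scalar (c * d) * q"
        for c d q
        by (rule scalar_left_commute) (simp add: scalar_simps(4) mult.assoc)
      show ?thesis
        by (simp add: d_def algebra_simps swap scalar_diff)
    qed
    then have "(\<Sum>i\<in>I. scalar (d i) * p ^ i) = scalar (of_nat j * e) * ?t - (z * ?t - ?t * z) +
      (\<Sum>i\<in>I. scalar (c i) * (z * p ^ i - p ^ i * z - scalar (of_nat i * e) * p ^ i))"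
      by (simp add: sum.distrib sum_subtractf sum_distrib_left sum_distrib_right)
    also have "\<dots> \<in> annihilator"
      by (intro annihilator_add annihilator_diff annihilator_sum annihilator_mult_left[OF t]
          annihilator_mult_right[OF t] annihilator_mult_left[OF comm_power])
    finally have "(\<Sum>i\<in>I. scalar (d i) * p ^ i) \<in> annihilator" .
    moreover have "(\<Sum>i\<in>I. scalar (d i) * p ^ i) = (\<Sum>i\<in>I - {j}. scalar (d i) * p ^ i)"
      using I(1) j by (subst sum.remove[of _ j]) (auto simp: d_def scalar_simps)
    ultimately have d: "(\<Sum>i\<in>I - {j}. scalar (d i) * p ^ i) \<in> annihilator" by simp
    show ?case
    proof (cases "I = {j}")
      case True
      then show ?thesis using t I(3)[OF j] annihilator_scalarD by auto
    next
      case False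
      \<comment> \<open>In characteristic \<open>0\<close> the factors \<open>(j - i) * e\<close>
        with \<open>i \<noteq> j\<close> are nonzero, so no further term is lost.\<close>
      then have "rel (I - {j}) d"
        unfolding rel_def using I d e j by (auto simp: d_def)
      moreover have "card (I - {j}) < card I"
        using I(1) j by (rule card_Diff1_less)
      ultimately show ?thesis using less.hyps by blast
    qed
  qed
  then show ?thesis
    using finitely_spanned_polynomial[OF fin, of p] unfolding rel_def by blast
qed

section \<open>Modules over the double of the Jordan plane\<close>

locale double_jordan_action = ncpoly_action_char_0 M act
  for M :: "('m, 'r) ring_scheme" (structure)
    and act :: "(djgen, 'k::field_char_0) ncpoly \<Rightarrow> 'm \<Rightarrow> 'm" +
  assumes relations_annihilate: "double_jordan_relations \<subseteq> annihilator"
begin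

abbreviation u :: "(djgen, 'k) ncpoly" where "u \<equiv> gen Gen_u"
abbreviation v :: "(djgen, 'k) ncpoly" where "v \<equiv> gen Gen_v"
abbreviation \<zeta> :: "(djgen, 'k) ncpoly" where "\<zeta> \<equiv> gen Gen_zeta"
abbreviation g :: "(djgen, 'k) ncpoly" where "g \<equiv> gen Gen_g"
abbreviation g' :: "(djgen, 'k) ncpoly" where "g' \<equiv> gen Gen_ginv"
abbreviation x :: "(djgen, 'k) ncpoly" where "x \<equiv> gen Gen_x"
abbreviation y :: "(djgen, 'k) ncpoly" where "y \<equiv> gen Gen_y"

lemma relations:
  shows g'_g: "g' * g - 1 \<in> annihilator"
    and \<zeta>_g: "\<zeta> * g - g * \<zeta> \<in> annihilator"
    and g_x: "g * x - x * g \<in> annihilator"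
    and g_y: "g * y - (y * g + x * g) \<in> annihilator"
    and \<zeta>_y: "\<zeta> * y - (y * \<zeta> + y) \<in> annihilator"
    and \<zeta>_x: "\<zeta> * x - (x * \<zeta> + x) \<in> annihilator"
    and u_g: "u * g - g * u \<in> annihilator"
    and v_g: "v * g - (g * v + g * u) \<in> annihilator"
    and v_\<zeta>: "v * \<zeta> - (\<zeta> * v + v) \<in> annihilator"
    and u_\<zeta>: "u * \<zeta> - (\<zeta> * u + u) \<in> annihilator"
    and y_x: "y * x - (x * y - scalar (1 / 2) * x ^ 2) \<in> annihilator"
    and v_u: "v * u - (u * v - scalar (1 / 2) * u ^ 2) \<in> annihilator"
    and u_x: "u * x - x * u \<in> annihilator"
    and v_x: "v * x - (x * v + (1 - g) + x * u) \<in> annihilator"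
    and u_y: "u * y - (y * u + (1 - g)) \<in> annihilator"
    and v_y: "v * y - (y * v - g * \<zeta> + y * u) \<in> annihilator"
  by (rule subsetD[OF relations_annihilate], simp add: double_jordan_relations_def Let_def)+

section \<open>The common kernel of \<open>x\<close>, \<open>u\<close> and
  \<open>1 - g\<close>\<close>

definition common_kernel :: "'m set" where
  "common_kernel = {m \<in> carrier M. act x m = \<zero> \<and> act u m = \<zero> \<and> act (1 - g) m = \<zero>}"

text \<open>Modulo the annihilator, \<open>p * q\<close> lies in the left ideal generated by
  \<open>x\<close>, \<open>u\<close> and \<open>1 - g\<close>, which kill \<open>m\<close>. Applied
  with \<open>p\<close> running through these three elements, this shows that a generator
  \<open>q\<close> preserves the common kernel.\<close>

lemma common_kernel_annihilated:
  assumes m: "m \<in> common_kernel" and pq: "p * q - (a * x + b * u + c * (1 - g)) \<in> annihilator"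
  shows "act p (act q m) = \<zero>"
proof -
  have "act p (act q m) = act (a * x + b * u + c * (1 - g)) m"
    using act_cong[OF pq, of m] m by (simp add: common_kernel_def act_mult)
  then show ?thesis
    using m by (simp add: common_kernel_def act_mult act_add_left)
qed

lemma common_kernel_fixed:
  assumes "m \<in> common_kernel"
  shows "act g m = m" "act g' m = m"
proof -
  have m: "m \<in> carrier M" "act (1 - g) m = \<zero>" using assms by (auto simp: common_kernel_def)
  show g: "act g m = m"
    using act_add_left[of m g "1 - g"] m by simp
  have "act g' (act g m) = m"
    using act_cong[OF g'_g m(1)] m(1) by (simp add: act_mult)
  then show "act g' m = m" by (simp add: g)
qed

text \<open>It suffices to treat scalars, which are central, and generators. Moving
  \<open>x\<close>, \<open>u\<close> and \<open>1 - g\<close> past \<open>v\<close>,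
  \<open>y\<close> or \<open>\<zeta>\<close> leaves a left combination of the same three elements;
  \<open>x\<close> and \<open>u\<close> act by zero, \<open>g\<close> and its inverse by the
  identity.\<close>

lemma common_kernel_act:
  assumes "m \<in> common_kernel"
  shows "act p m \<in> common_kernel"
proof -
  have "p \<in> carrier (free_algebra UNIV)" by (simp add: free_algebra_simps)
  then show ?thesis using assms
  proof (induction p arbitrary: m rule: free_algebra_induct)
    case (scalar c)
    have "act p (act (scalar c) m) = \<zero>" if "act p m = \<zero>" "m \<in> carrier M" for p m
      using that act_mult[of m p "scalar c"] act_mult[of m "scalar c" p] by (simp add: scalar_commute)
    then show ?case using scalar by (simp add: common_kernel_def)
  next
    case (gen t)
    note m = gen.prems
    then have mM: "m \<in> carrier M" by (simp add: common_kernel_def)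
    note step = common_kernel_annihilated[OF m]
    show ?case
    proof (cases t)
      case Gen_v
      have "x * v - (v * x + (- x) * u + (- 1) * (1 - g)) \<in> annihilator"
        using annihilator_uminus[OF v_x] by (simp add: algebra_simps)
      moreover have "u * v - (0 * x + (v + scalar (1 / 2) * u) * u + 0 * (1 - g)) \<in> annihilator"
        using annihilator_uminus[OF v_u] by (simp add: algebra_simps power2_eq_square)
      moreover have "(1 - g) * v - (0 * x + g * u + v * (1 - g)) \<in> annihilator"
        using v_g by (simp add: algebra_simps)
      ultimately show ?thesis
        using mM step unfolding common_kernel_def Gen_v by blast
    next
      case Gen_y
      have "x * y - ((y + scalar (1 / 2) * x) * x + 0 * u + 0 * (1 - g)) \<in> annihilator"
        using annihilator_uminus[OF y_x] by (simp add: algebra_simps power2_eq_square)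
      moreover have "u * y - (0 * x + y * u + 1 * (1 - g)) \<in> annihilator"
        using u_y by (simp add: algebra_simps)
      moreover have "(1 - g) * y - ((- g) * x + 0 * u + y * (1 - g)) \<in> annihilator"
        using annihilator_diff[OF g_x g_y] by (simp add: algebra_simps)
      ultimately show ?thesis
        using mM step unfolding common_kernel_def Gen_y by blast
    next
      case Gen_zeta
      have "x * \<zeta> - ((\<zeta> - 1) * x + 0 * u + 0 * (1 - g)) \<in> annihilator"
        using annihilator_uminus[OF \<zeta>_x] by (simp add: algebra_simps)
      moreover have "u * \<zeta> - (0 * x + (\<zeta> + 1) * u + 0 * (1 - g)) \<in> annihilator"
        using u_\<zeta> by (simp add: algebra_simps)
      moreover have "(1 - g) * \<zeta> - (0 * x + 0 * u + \<zeta> * (1 - g)) \<in> annihilator"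
        using \<zeta>_g by (simp add: algebra_simps)
      ultimately show ?thesis
        using mM step unfolding common_kernel_def Gen_zeta by blast
    qed (use m common_kernel_fixed[OF m] in \<open>auto simp: common_kernel_def\<close>)
  next
    case (add p q)
    then show ?case by (simp add: common_kernel_def act_add_left act_add_right)
  next
    case (mult p q)
    then show ?case by (simp add: act_mult common_kernel_def)
  qed
qed

text \<open>The Leibniz rule for the commutator with \<open>y\<close>: modulo the annihilator
  \<open>[u, y] = 1 - g\<close> commutes with \<open>u\<close>, so the \<open>n + 1\<close> terms
  coincide.\<close>

lemma u_power_y: "u ^ Suc n * y - y * u ^ Suc n - scalar (of_nat (Suc n)) * (u ^ n * (1 - g)) \<in> annihilator"
proof (induction n)
  case 0
  then show ?case using u_y by (simp add: scalar_simps algebra_simps)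
next
  case (Suc n)
  have g_u: "g * u ^ Suc n - u ^ Suc n * g \<in> annihilator"
    by (rule annihilator_commute_power) (use annihilator_uminus[OF u_g] in simp)
  have c: "scalar (of_nat (Suc (Suc n))) = scalar (of_nat (Suc n)) + (1 :: (djgen, 'k) ncpoly)"
    by (simp only: of_nat_Suc[of "Suc n"] scalar_simps add.commute)
  \<comment> \<open>The relation \<open>u_y\<close> moves \<open>y\<close> past the remaining factor
    \<open>u\<close>, and \<open>g_u\<close> brings \<open>1 - g\<close> to the right of the
    power.\<close>
  have "u ^ Suc (Suc n) * y - y * u ^ Suc (Suc n) - scalar (of_nat (Suc (Suc n))) * (u ^ Suc n * (1 - g)) =
    u * (u ^ Suc n * y - y * u ^ Suc n - scalar (of_nat (Suc n)) * (u ^ n * (1 - g))) +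
    (u * y - (y * u + (1 - g))) * u ^ Suc n - (g * u ^ Suc n - u ^ Suc n * g)"
    unfolding c by (simp add: algebra_simps scalar_left_commute del: of_nat_Suc)
  then show ?case
    using Suc u_y g_u by (metis annihilator_add annihilator_diff annihilator_mult_left annihilator_mult_right)
qed

text \<open>
  If \<open>n\<close> is the order of nilpotency of \<open>u\<close> then \<open>u ^ n = 0\<close> and \<open>u_power_y\<close> give
  \<open>u ^ (n - 1) * (1 - g) = 0\<close>, so the image of \<open>u ^ (n - 1)\<close> is killed by \<open>u\<close> and \<open>1 - g\<close>.
\<close>

lemma common_kernel_nonzero:
  assumes fin: finitely_spanned and nonzero: "carrier M \<noteq> {\<zero>}"
  shows "\<exists>m\<in>common_kernel. m \<noteq> \<zero>"
proof -
  have "\<exists>n. u ^ n \<in> annihilator"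
    by (rule eigenvector_nilpotent[OF fin, of "- 1" \<zeta>])
       (use annihilator_uminus[OF u_\<zeta>] in \<open>simp_all add: scalar_simps algebra_simps\<close>)
  then have u_nil: "u ^ (LEAST n. u ^ n \<in> annihilator) \<in> annihilator" by (rule LeastI_ex)
  have one: "1 \<notin> annihilator"
  proof
    assume "1 \<in> annihilator"
    then have "\<forall>m\<in>carrier M. m = \<zero>" by (simp add: annihilator_def)
    with nonzero show False by auto
  qed
  \<comment> \<open>The order of nilpotency is positive, because \<open>1\<close> does not
    annihilate a nonzero module.\<close>
  obtain n where n: "(LEAST n. u ^ n \<in> annihilator) = Suc n"
    using u_nil one by (cases "LEAST n. u ^ n \<in> annihilator") auto
  have u_Suc_n: "u ^ Suc n \<in> annihilator" using u_nil by (simp add: n del: power_Suc)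
  have u_n: "u ^ n \<notin> annihilator" using not_less_Least[of n "\<lambda>n. u ^ n \<in> annihilator"] n by simp
  have "scalar (of_nat (Suc n)) * (u ^ n * (1 - g)) \<in> annihilator"
    using annihilator_diff[OF annihilator_diff[OF annihilator_mult_right[OF u_Suc_n, of y]
      annihilator_mult_left[OF u_Suc_n, of y]] u_power_y[of n]] by simp
  \<comment> \<open>Characteristic \<open>0\<close> allows division by \<open>n + 1\<close>.\<close>
  then have u_n_g: "u ^ n * (1 - g) \<in> annihilator"
    by (rule annihilator_scalarD) (metis of_nat_eq_0_iff nat.distinct(1))
  obtain m where m: "m \<in> carrier M" "act (u ^ n) m \<noteq> \<zero>"
    using u_n by (auto simp: annihilator_def)
  define w where "w = act (u ^ n) m"
  have w: "w \<in> carrier M" "w \<noteq> \<zero>" using m by (auto simp: w_def)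
  have uw: "act u w = \<zero>"
    using annihilator_act[OF u_Suc_n m(1)] m(1) by (simp add: w_def act_mult)
  have "g * u ^ n - u ^ n * g \<in> annihilator"
    by (rule annihilator_commute_power) (use annihilator_uminus[OF u_g] in simp)
  from annihilator_diff[OF u_n_g this] have "(1 - g) * u ^ n \<in> annihilator"
    by (simp add: algebra_simps)
  then have gw: "act (1 - g) w = \<zero>"
    using m(1) by (simp add: w_def annihilator_act flip: act_mult)
  \<comment> \<open>Modulo the annihilator \<open>x\<close> commutes with \<open>u\<close> and
    \<open>g\<close>, so applying powers of \<open>x\<close> to \<open>w\<close> gives vectors still
    killed by \<open>u\<close> and \<open>1 - g\<close>; the last nonzero one is killed by
    \<open>x\<close> as well.\<close>
  have "\<exists>k. x ^ k \<in> annihilator"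
    by (rule eigenvector_nilpotent[OF fin, of 1 \<zeta>])
       (use \<zeta>_x in \<open>simp_all add: scalar_simps algebra_simps\<close>)
  then have "\<exists>k. act (x ^ k) w = \<zero>" using w annihilator_act by blast
  then have x_nil: "act (x ^ (LEAST k. act (x ^ k) w = \<zero>)) w = \<zero>" by (rule LeastI_ex)
  obtain k where k: "(LEAST k. act (x ^ k) w = \<zero>) = Suc k"
    using x_nil w by (cases "LEAST k. act (x ^ k) w = \<zero>") auto
  have nz: "act (x ^ k) w \<noteq> \<zero>" using not_less_Least[of k "\<lambda>k. act (x ^ k) w = \<zero>"] k by simp
  have "act x (act (x ^ k) w) = \<zero>"
    using x_nil w by (simp add: k act_mult)
  moreover have "act p (act (x ^ k) w) = \<zero>" if p: "p * x - x * p \<in> annihilator" and "act p w = \<zero>" for p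
    using act_cong[OF annihilator_commute_power[OF p, of k] w(1)] that w by (simp add: act_mult)
  from this[OF _ uw] this[OF _ gw] have "act u (act (x ^ k) w) = \<zero>" "act (1 - g) (act (x ^ k) w) = \<zero>"
    using u_x annihilator_uminus[OF g_x] by (simp_all add: algebra_simps)
  ultimately have "act (x ^ k) w \<in> common_kernel"
    using w by (simp add: common_kernel_def)
  with nz show ?thesis by blast
qed

end

text \<open>A traceless \<open>a\<close> has coordinates \<open>a $ 1 $ 2\<close>,
  \<open>a $ 2 $ 1\<close> and \<open>a $ 1 $ 1\<close> along \<open>e\<close>, \<open>f\<close> and
  \<open>h\<close>. These basis vectors go to \<open>4 v\<close>, \<open>y / 2\<close> and
  \<open>- 2 \<zeta>\<close>, which undoes the projection on generators.\<close>

definition sl2_lift :: "'k::field mat2 \<Rightarrow> (djgen, 'k) ncpoly" where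
  "sl2_lift a = scalar (4 * a $ 1 $ 2) * gen Gen_v + scalar (a $ 2 $ 1 / 2) * gen Gen_y +
     scalar (- 2 * a $ 1 $ 1) * gen Gen_zeta"

lemma sl2_lift_simps:
  fixes a b :: "'k::field mat2"
  shows "sl2_lift (a + b) = sl2_lift a + sl2_lift b"
    and "sl2_lift (matrix_scale c a) = scalar c * sl2_lift a"
proof -
  have swap: "scalar c * (scalar d * p) = scalar (c * d) * p" for d and p :: "(djgen, 'k) ncpoly"
    by (simp add: scalar_simps(4) mult.assoc)
  show "sl2_lift (a + b) = sl2_lift a + sl2_lift b"
    by (simp add: sl2_lift_def scalar_simps(3,5) scalar_diff algebra_simps add_divide_distrib)
  show "sl2_lift (matrix_scale c a) = scalar c * sl2_lift a"
    by (simp add: sl2_lift_def matrix_scale_def scalar_simps(5) swap algebra_simps)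
qed

lemma sl2_diag:
  fixes a :: "'k::field mat2"
  assumes "a \<in> sl2"
  shows "a $ 2 $ 2 = - a $ 1 $ 1"
proof -
  have "a $ 1 $ 1 + a $ 2 $ 2 = 0"
    using assms by (simp add: sl2_def trace_def sum_2)
  from minus_unique[OF this] show ?thesis by (rule sym)
qed

text \<open>By bilinearity and antisymmetry the defect of \<open>sl2_lift\<close> from a Lie
  homomorphism is a combination of the defects on \<open>(e, f)\<close>, \<open>(h, e)\<close> and
  \<open>(h, f)\<close>, weighted by the two by two minors of the coordinates. The factors
  \<open>2\<close>, \<open>8\<close> and \<open>1\<close> come from the scalings \<open>4\<close>,
  \<open>1 / 2\<close> and \<open>- 2\<close> of the generators.\<close>

lemma sl2_lift_commutator:
  fixes a b :: "'k::field_char_0 mat2"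
  assumes "a \<in> sl2" "b \<in> sl2"
  defines "v \<equiv> gen Gen_v" and "y \<equiv> gen Gen_y" and "z \<equiv> gen Gen_zeta"
  shows "sl2_lift a * sl2_lift b - sl2_lift b * sl2_lift a - sl2_lift (matrix_bracket a b) =
    scalar (2 * (a $ 1 $ 2 * b $ 2 $ 1 - a $ 2 $ 1 * b $ 1 $ 2)) * (v * y - y * v + z) +
    scalar (8 * (a $ 1 $ 1 * b $ 1 $ 2 - a $ 1 $ 2 * b $ 1 $ 1)) * (v * z - z * v - v) +
    scalar (a $ 1 $ 1 * b $ 2 $ 1 - a $ 2 $ 1 * b $ 1 $ 1) * (y * z - z * y + y)"
proof -
  have tr: "a $ 2 $ 2 = - a $ 1 $ 1" "b $ 2 $ 2 = - b $ 1 $ 1"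
    using sl2_diag assms(1,2) by auto
  have br: "matrix_bracket a b $ 1 $ 1 = a $ 1 $ 2 * b $ 2 $ 1 - a $ 2 $ 1 * b $ 1 $ 2"
    "matrix_bracket a b $ 1 $ 2 = 2 * (a $ 1 $ 1 * b $ 1 $ 2 - a $ 1 $ 2 * b $ 1 $ 1)"
    "matrix_bracket a b $ 2 $ 1 = 2 * (a $ 2 $ 1 * b $ 1 $ 1 - a $ 1 $ 1 * b $ 2 $ 1)"
    by (simp_all add: matrix_bracket_def matrix_matrix_mult_def sum_2 tr algebra_simps)
  have swap: "gen t * (scalar c * p) = scalar c * (gen t * p)"
    "scalar c * (scalar d * p) = scalar (c * d) * p"
    for t c d and p :: "(djgen, 'k) ncpoly"
    by (rule scalar_left_commute) (simp add: scalar_simps(4) mult.assoc)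
  show ?thesis
    unfolding sl2_lift_def br v_def y_def z_def
    by (simp add: algebra_simps swap scalar_diff scalar_simps(3,5) diff_divide_distrib)
qed

text \<open>Once \<open>u\<close> and \<open>1 - g\<close> act as zero, the three Chevalley
  relations hold for the lifts, and the commutator identity extends them to all brackets.\<close>

lemma (in double_jordan_action) sl2_lift_relations:
  assumes ann: "u \<in> annihilator" "1 - g \<in> annihilator" and r: "r \<in> sl2_relations"
  shows "ncpoly_subst sl2_lift r \<in> annihilator"
proof -
  \<comment> \<open>Replacing \<open>y * u\<close> by zero and \<open>g * \<zeta>\<close> by
    \<open>\<zeta>\<close> turns the relation \<open>v_y\<close> into
    \<open>[v, y] = - \<zeta>\<close>.\<close>
  have "v * y - y * v + \<zeta> \<in> annihilator"
    using annihilator_add[OF annihilator_add[OF v_y annihilator_mult_left[OF ann(1), of y]]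
      annihilator_mult_right[OF ann(2), of \<zeta>]] by (simp add: algebra_simps)
  moreover have "v * \<zeta> - \<zeta> * v - v \<in> annihilator" using v_\<zeta> by (simp add: algebra_simps)
  moreover have "y * \<zeta> - \<zeta> * y + y \<in> annihilator"
    using annihilator_uminus[OF \<zeta>_y] by (simp add: algebra_simps)
  ultimately have "sl2_lift a * sl2_lift b - sl2_lift b * sl2_lift a - sl2_lift (matrix_bracket a b) \<in> annihilator"
    if "a \<in> sl2" "b \<in> sl2" for a b
    unfolding sl2_lift_commutator[OF that] using annihilator_mult_left by (intro annihilator_add)
  then show ?thesis
    using r unfolding sl2_relations_def enveloping_relations_def
    by (auto simp: ncpoly_subst_simps sl2_lift_simps annihilator_0)
qed

text \<open>The composite of the two substitutions fixes each generator modulo the annihilator, and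
  this extends to sums and products. Hence the action of \<open>p\<close> depends only on its image
  in the free algebra on \<open>sl2\<close>.\<close>

lemma (in double_jordan_action) sl2_lift_proj:
  assumes ann: "x \<in> annihilator" "u \<in> annihilator" "1 - g \<in> annihilator"
  shows "p - ncpoly_subst sl2_lift (ncpoly_subst double_jordan_proj_gen p) \<in> annihilator"
proof -
  let ?f = "\<lambda>p. ncpoly_subst sl2_lift (ncpoly_subst double_jordan_proj_gen p)"
  have "p \<in> carrier (free_algebra UNIV)" by (simp add: free_algebra_simps)
  then show ?thesis
  proof (induction p rule: free_algebra_induct)
    case (scalar c)
    then show ?case by (simp add: annihilator_0)
  next
    case (gen t)
    have "g' - 1 \<in> annihilator"
      using annihilator_add[OF annihilator_mult_left[OF ann(3), of g'] g'_g] by (simp add: algebra_simps)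
    moreover have "g - 1 \<in> annihilator" using annihilator_uminus[OF ann(3)] by simp
    moreover have "sl2_lift sl2_e = scalar 4 * v" "sl2_lift sl2_f = scalar (1 / 2) * y"
      "sl2_lift sl2_h = scalar (- 2) * \<zeta>"
      by (simp_all add: sl2_lift_def sl2_e_def sl2_f_def sl2_h_def scalar_simps(1))
    ultimately show ?case
      using ann by (cases t)
        (simp_all add: double_jordan_proj_gen_def ncpoly_subst_simps annihilator_0 scalar_simps(2)
          flip: scalar_simps(4) mult.assoc)
  next
    case (add p q)
    then show ?case
      using annihilator_add[of "p - ?f p" "q - ?f q"] by (simp add: ncpoly_subst_simps algebra_simps)
  next
    case (mult p q)
    have "p * q - ?f p * ?f q = (p - ?f p) * q + ?f p * (q - ?f q)"
      by (simp add: algebra_simps)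
    then show ?case
      using mult annihilator_add annihilator_mult_left annihilator_mult_right
      by (simp add: ncpoly_subst_simps)
  qed
qed

section \<open>The projection onto the enveloping algebra\<close>

lemma carrier_free_algebra_UNIV [simp]: "p \<in> carrier (free_algebra UNIV)"
  by (simp add: free_algebra_simps)

lemma presented_algebra_smult_one_closed:
  assumes "R \<subseteq> carrier (free_algebra S)"
  shows "c \<odot>\<^bsub>presented_algebra S R\<^esub> \<one>\<^bsub>presented_algebra S R\<^esub> \<in> carrier (presented_algebra S R)"
  using presented_algebra_simps(5,9,11)[OF assms] by (simp add: free_algebra_closed)

section \<open>Modules over a presented algebra as actions of polynomials\<close>

context
  fixes R :: "('x, 'k::field) ncpoly set" and M :: "(('x, 'k) ncpoly set, 'm) module"
  assumes M: "left_module (presented_algebra UNIV R) M"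
begin

abbreviation (input) "presented_act p m \<equiv>
  (Idl\<^bsub>free_algebra UNIV\<^esub> R +>\<^bsub>free_algebra UNIV\<^esub> p) \<odot>\<^bsub>M\<^esub> m"

text \<open>The module axioms pull back along the quotient map, which is a ring homomorphism; with
  \<open>UNIV\<close> as the set of generators it is defined on every polynomial.\<close>

lemma ncpoly_action_presented: "ncpoly_action M presented_act"
proof -
  let ?F = "free_algebra UNIV :: ('x, 'k) ncpoly ring"
  have R: "R \<subseteq> carrier ?F" by auto
  note A = presented_algebra_simps[OF R]
  interpret M: left_module "presented_algebra UNIV R" M by (rule M)
  have cl: "Idl\<^bsub>?F\<^esub> R +>\<^bsub>?F\<^esub> p \<in> carrier (presented_algebra UNIV R)" for p
    by (simp add: A(5))
  show ?thesis
  proof (intro ncpoly_action.intro ncpoly_action_axioms.intro M.abelian_group_axioms)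
    show "presented_act 1 m = m" if "m \<in> carrier M" for m
      using M.smult_one[OF that] by (simp add: A(9))
  qed (simp_all add: cl M.smult_r_distr flip: A(7,8) M.smult_l_distr M.smult_assoc1)
qed

lemma presented_relations_annihilate: "R \<subseteq> ncpoly_action.annihilator M presented_act"
proof
  let ?F = "free_algebra UNIV :: ('x, 'k) ncpoly ring"
  fix r assume r: "r \<in> R"
  have R: "R \<subseteq> carrier ?F" by auto
  interpret ncpoly_action M presented_act by (rule ncpoly_action_presented)
  have "Idl\<^bsub>?F\<^esub> R +>\<^bsub>?F\<^esub> r = Idl\<^bsub>?F\<^esub> R +>\<^bsub>?F\<^esub> 0"
    using presented_algebra_simps(2)[OF R] presented_algebra_simps(6)[OF R, of r 0] r by auto
  then show "r \<in> annihilator"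
    unfolding annihilator_def using act_0_left by simp
qed

lemma presented_finitely_spanned:
  assumes "finite_dimensional_module (presented_algebra UNIV R) M"
  shows "ncpoly_action.finitely_spanned M presented_act"
proof -
  have R: "R \<subseteq> carrier (free_algebra UNIV)" by auto
  have "base_smult (presented_algebra UNIV R) M c m = presented_act (scalar c) m" for c m
    using presented_algebra_simps(9,11)[OF R] by (simp add: base_smult_def)
  then show ?thesis
    using assms unfolding finite_dimensional_module_def
      ncpoly_action.finitely_spanned_def[OF ncpoly_action_presented] by simp
qed

end

text \<open>The polynomials whose substitution acts as zero form an ideal containing
  \<open>R\<close>, hence containing the ideal generated by \<open>R\<close>.\<close>

lemma ideal_vimage_ncpoly_action:
  assumes act: "ncpoly_action M act"
    and R: "R \<subseteq> carrier (free_algebra S)"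
    and rel: "\<And>r. r \<in> R \<Longrightarrow> ncpoly_subst f r \<in> ncpoly_action.annihilator M act"
    and p: "p \<in> Idl\<^bsub>free_algebra S\<^esub> R"
  shows "ncpoly_subst f p \<in> ncpoly_action.annihilator M act"
proof -
  let ?F = "free_algebra S"
  interpret ncpoly_action M act by (rule act)
  interpret F: ring ?F by (rule ring_free_algebra)
  let ?J = "{p \<in> carrier ?F. ncpoly_subst f p \<in> annihilator}"
  have "ideal ?J ?F"
  proof (rule idealI[OF F.ring_axioms])
    show "subgroup ?J (add_monoid ?F)"
    proof (rule F.add.subgroupI)
      show "?J \<noteq> {}"
        using annihilator_0 free_algebra_closed(1) ncpoly_subst_0 by (metis (mono_tags, lifting) empty_iff mem_Collect_eq)
      show "\<ominus>\<^bsub>?F\<^esub> p \<in> ?J" if "p \<in> ?J" for p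
      proof -
        have "\<ominus>\<^bsub>?F\<^esub> p = - p"
          by (rule F.minus_equality) (use that in \<open>auto simp: free_algebra_simps(2-) free_algebra_closed\<close>)
        then show ?thesis
          using that by (simp add: free_algebra_closed ncpoly_subst_uminus annihilator_uminus)
      qed
    qed (auto simp: free_algebra_simps(2-) free_algebra_closed ncpoly_subst_add annihilator_add)
  qed (auto simp: free_algebra_simps(2-) free_algebra_closed ncpoly_subst_mult annihilator_mult_left
      annihilator_mult_right)
  then show ?thesis
    using F.genideal_minimal[of ?J R] R rel p by blast
qed

section \<open>The projection on representatives\<close>

lemma double_jordan_proj_gen_closed:
  "(double_jordan_proj_gen t :: ('k mat2, 'k::field) ncpoly) \<in> carrier (free_algebra sl2)"
  using sl2_chevalley[where 'k = 'k]
  by (auto simp: double_jordan_proj_gen_def free_algebra_closed split: djgen.split)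

lemma ncpoly_subst_double_jordan_proj_gen_closed:
  "ncpoly_subst double_jordan_proj_gen p \<in> carrier (free_algebra sl2)"
  by (rule ncpoly_subst_closed[of UNIV]) (simp_all add: double_jordan_proj_gen_closed)

text \<open>The projection is given by a definite description. It agrees on generators with the
  homomorphism induced by substitution, and homomorphisms out of a presented algebra are determined
  on generators.\<close>

lemma double_jordan_proj_coset:
  fixes p :: "(djgen, 'k::field_char_0) ncpoly"
  shows "double_jordan_proj (Idl\<^bsub>free_algebra UNIV\<^esub> double_jordan_relations +>\<^bsub>free_algebra UNIV\<^esub> p) =
    Idl\<^bsub>free_algebra sl2\<^esub> sl2_relations +>\<^bsub>free_algebra sl2\<^esub> ncpoly_subst double_jordan_proj_gen p"
proof -
  let ?F = "free_algebra UNIV :: (djgen, 'k) ncpoly ring"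
  let ?F' = "free_algebra sl2 :: ('k mat2, 'k) ncpoly ring"
  let ?I = "Idl\<^bsub>?F\<^esub> double_jordan_relations" and ?J = "Idl\<^bsub>?F'\<^esub> sl2_relations"
  let ?D = "double_jordan :: ('k, _) module" and ?U = "U_sl2 :: ('k, _) module"
  let ?\<pi> = "double_jordan_proj :: (djgen, 'k) ncpoly set \<Rightarrow> _"
  note A = presented_algebra_simps[OF double_jordan_relations_closed[where 'k = 'k], folded double_jordan_def]
  note B = presented_algebra_simps[OF sl2_relations_closed[where 'k = 'k], folded U_sl2_def]
  note ch = sl2_chevalley[where 'k = 'k]
  interpret D: ring ?D by (rule A(3))
  interpret U: ring ?U by (rule B(3))
  have \<pi>: "algebra_hom ?D ?U ?\<pi>" using double_jordan_proj[where 'k = 'k] by (simp add: is_double_jordan_proj_def)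
  interpret h: ring_hom_ring ?D ?U ?\<pi>
    using \<pi> by (intro ring_hom_ringI2 A(3) B(3)) (simp add: algebra_hom_def)
  have genD: "double_jordan_gen t \<in> carrier ?D" for t
    by (auto simp: double_jordan_gen_def presented_gen_def A(5))
  have g: "?\<pi> (double_jordan_gen Gen_g) = \<one>\<^bsub>?U\<^esub>"
    using double_jordan_proj[where 'k = 'k] genD[of Gen_g]
    by (simp add: is_double_jordan_proj_def a_minus_def) (metis U.one_closed U.r_right_minus_eq a_minus_def h.hom_closed)
  \<comment> \<open>No value is prescribed at the inverse of \<open>g\<close>; the relation
    \<open>g * g' = 1\<close> forces it to be \<open>1\<close>.\<close>
  have "gen Gen_g * gen Gen_ginv - 1 \<in> ?I"
    by (rule subsetD[OF A(2)]) (simp add: double_jordan_relations_def Let_def)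
  then have "double_jordan_gen Gen_g \<otimes>\<^bsub>?D\<^esub> double_jordan_gen Gen_ginv = \<one>\<^bsub>?D\<^esub>"
    by (simp add: double_jordan_gen_def presented_gen_def A(6,7,9))
  then have "?\<pi> (double_jordan_gen Gen_g) \<otimes>\<^bsub>?U\<^esub> ?\<pi> (double_jordan_gen Gen_ginv) = \<one>\<^bsub>?U\<^esub>"
    using genD by (metis h.hom_mult h.hom_one)
  then have g': "?\<pi> (double_jordan_gen Gen_ginv) = \<one>\<^bsub>?U\<^esub>"
    using genD[of Gen_ginv] by (simp add: g)
  obtain \<phi> where \<phi>: "algebra_hom ?D ?U \<phi>"
    "\<And>p. \<phi> (?I +>\<^bsub>?F\<^esub> p) = ?J +>\<^bsub>?F'\<^esub> ncpoly_subst double_jordan_proj_gen p"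
    using presented_algebra_hom_exists[where f = double_jordan_proj_gen, OF double_jordan_relations_closed
        sl2_relations_closed double_jordan_proj_gen_closed double_jordan_proj_relations[where 'k = 'k]]
    by (auto simp: double_jordan_def U_sl2_def)
  have "?\<pi> (double_jordan_gen t) = ?J +>\<^bsub>?F'\<^esub> double_jordan_proj_gen t" for t
    using double_jordan_proj[where 'k = 'k] ch
    by (cases t) (simp_all add: g g' is_double_jordan_proj_def double_jordan_proj_gen_def B(9-11)
        free_algebra_closed U_sl2_incl_def presented_gen_def)
  then have "?\<pi> (double_jordan_gen t) = \<phi> (double_jordan_gen t)" for t
    by (simp add: double_jordan_gen_def presented_gen_def \<phi>(2))
  then have "?\<pi> a = \<phi> a" if "a \<in> carrier ?D" for a
    using presented_algebra_hom_unique[OF double_jordan_relations_closed B(3), of ?\<pi> \<phi> a] \<pi> \<phi>(1) that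
    by (simp add: double_jordan_def double_jordan_gen_def)
  then show ?thesis by (simp add: A(5) \<phi>(2))
qed

text \<open>Lifting a polynomial by \<open>sl2_lift\<close> and projecting it back changes it only
  by an element of the ideal of relations, so every coset in the target is attained.\<close>

lemma double_jordan_proj_surj:
  "double_jordan_proj ` carrier double_jordan = (carrier U_sl2 :: ('k::field_char_0 mat2, 'k) ncpoly set set)"
proof -
  let ?F' = "free_algebra sl2 :: ('k mat2, 'k) ncpoly ring"
  let ?J = "Idl\<^bsub>?F'\<^esub> sl2_relations"
  note A = presented_algebra_simps[OF double_jordan_relations_closed[where 'k = 'k], folded double_jordan_def]
  note B = presented_algebra_simps[OF sl2_relations_closed[where 'k = 'k], folded U_sl2_def]
  interpret J: ideal ?J ?F' by (rule B(1))
  note ch = sl2_chevalley[where 'k = 'k]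
  let ?s = "\<lambda>q. ncpoly_subst double_jordan_proj_gen (ncpoly_subst sl2_lift q) :: ('k mat2, 'k) ncpoly"
  note clp = ncpoly_subst_double_jordan_proj_gen_closed
  have J_add: "p + q \<in> ?J" if "p \<in> ?J" "q \<in> ?J" for p q
    using additive_subgroup.a_closed[OF J.is_additive_subgroup that] by (simp add: free_algebra_simps(2-))
  have J_mult: "r * p \<in> ?J" "p * r \<in> ?J" if "p \<in> ?J" "r \<in> carrier ?F'" for p r
    using J.I_l_closed[OF that] J.I_r_closed[OF that] by (simp_all add: free_algebra_simps(2-))
  have zero: "0 \<in> ?J" using additive_subgroup.zero_closed[OF J.is_additive_subgroup] by (simp add: free_algebra_simps(2-))
  have rel_add: "gen (a + b) - (gen a + gen b) \<in> ?J" if "a \<in> sl2" "b \<in> sl2" for a b :: "'k mat2"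
    by (rule subsetD[OF B(2)]) (use that in \<open>auto simp: sl2_relations_def enveloping_relations_def\<close>)
  have rel_scale: "gen (matrix_scale c a) - scalar c * gen a \<in> ?J" if "a \<in> sl2" for a :: "'k mat2" and c
    by (rule subsetD[OF B(2)]) (use that in \<open>auto simp: sl2_relations_def enveloping_relations_def\<close>)
  have "q - ?s q \<in> ?J" if "q \<in> carrier ?F'" for q
    using that
  proof (induction q rule: free_algebra_induct)
    case (scalar c)
    then show ?case by (simp add: zero)
  next
    case (gen a)
    let ?e = "matrix_scale (a $ 1 $ 2) sl2_e" and ?f = "matrix_scale (a $ 2 $ 1) sl2_f"
      and ?h = "matrix_scale (a $ 1 $ 1) sl2_h"
    have s: "ncpoly_subst double_jordan_proj_gen (sl2_lift a) = scalar (a $ 1 $ 2) * gen sl2_e + scalar (a $ 2 $ 1) * gen sl2_f +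
        scalar (a $ 1 $ 1) * gen sl2_h"
      by (simp add: sl2_lift_def ncpoly_subst_simps double_jordan_proj_gen_def flip: scalar_simps(4) mult.assoc)
    have a: "?e + ?f + ?h = a"
      using sl2_diag[OF gen]
      by (simp add: vec_eq_iff forall_2 matrix_scale_def sl2_e_def sl2_f_def sl2_h_def)
    have sl2: "?e \<in> sl2" "?f \<in> sl2" "?h \<in> sl2" "?e + ?f \<in> sl2"
      using ch sl2_closed by blast+
    \<comment> \<open>In the free algebra \<open>gen\<close> is not linear, so decomposing
      \<open>a\<close> along \<open>e\<close>, \<open>f\<close> and \<open>h\<close> costs two
      additivity relations and three scaling relations.\<close>
    have "gen (?e + ?f + ?h) - ?s (gen a) = (gen (?e + ?f + ?h) - (gen (?e + ?f) + gen ?h)) +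
        (gen (?e + ?f) - (gen ?e + gen ?f)) + (gen ?e - scalar (a $ 1 $ 2) * gen sl2_e) +
        (gen ?f - scalar (a $ 2 $ 1) * gen sl2_f) + (gen ?h - scalar (a $ 1 $ 1) * gen sl2_h)"
      by (simp add: s)
    also have "\<dots> \<in> ?J"
      by (intro J_add rel_add rel_scale sl2 ch)
    finally show ?case unfolding a .
  next
    case (add p q)
    then show ?case
      using J_add[of "p - ?s p" "q - ?s q"]
      by (simp add: ncpoly_subst_simps algebra_simps)
  next
    case (mult p q)
    have "p * q - ?s p * ?s q = (p - ?s p) * q + ?s p * (q - ?s q)"
      by (simp add: algebra_simps)
    also have "\<dots> \<in> ?J"
      using mult by (intro J_add J_mult clp)
    finally show ?case by (simp add: ncpoly_subst_simps)
  qed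
  then have lift: "?J +>\<^bsub>?F'\<^esub> q = ?J +>\<^bsub>?F'\<^esub> ?s q" if "q \<in> carrier ?F'" for q
    using B(6)[OF that clp] that by simp
  show ?thesis
  proof (intro equalityI subsetI)
    fix b :: "('k mat2, 'k) ncpoly set" assume "b \<in> double_jordan_proj ` carrier double_jordan"
    then show "b \<in> carrier U_sl2"
      by (auto simp: A(5) B(5) double_jordan_proj_coset intro!: imageI clp)
  next
    fix b :: "('k mat2, 'k) ncpoly set" assume "b \<in> carrier U_sl2"
    then obtain q where "q \<in> carrier ?F'" "b = ?J +>\<^bsub>?F'\<^esub> q" by (auto simp: B(5))
    then show "b \<in> double_jordan_proj ` carrier double_jordan"
      using lift by (simp add: A(5) image_image double_jordan_proj_coset)
  qed
qed

text \<open>By simplicity the nonzero submodule \<open>common_kernel\<close> is all of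
  \<open>M\<close>, so \<open>x\<close>, \<open>u\<close> and \<open>1 - g\<close> act as zero and
  the action can be read off from images under the projection.\<close>

lemma double_jordan_proj_kernel_annihilates:
  fixes M :: "((djgen, 'k::field_char_0) ncpoly set, 'm) module"
  assumes M: "fd_simple_module double_jordan M"
    and a: "a \<in> carrier double_jordan" "b \<in> carrier double_jordan" "double_jordan_proj a = double_jordan_proj b"
    and m: "m \<in> carrier M"
  shows "a \<odot>\<^bsub>M\<^esub> m = b \<odot>\<^bsub>M\<^esub> m"
proof -
  let ?F = "free_algebra UNIV :: (djgen, 'k) ncpoly ring"
  let ?F' = "free_algebra sl2 :: ('k mat2, 'k) ncpoly ring"
  let ?I = "Idl\<^bsub>?F\<^esub> double_jordan_relations" and ?J = "Idl\<^bsub>?F'\<^esub> sl2_relations"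
  note A = presented_algebra_simps[OF double_jordan_relations_closed[where 'k = 'k], folded double_jordan_def]
  note B = presented_algebra_simps[OF sl2_relations_closed[where 'k = 'k], folded U_sl2_def]
  have lm: "left_module (presented_algebra UNIV double_jordan_relations) M"
    and fd: "finite_dimensional_module (presented_algebra UNIV double_jordan_relations) M"
    and nonzero: "carrier M \<noteq> {\<zero>\<^bsub>M\<^esub>}"
    and simple: "\<And>N. submodule N double_jordan M \<Longrightarrow> N = {\<zero>\<^bsub>M\<^esub>} \<or> N = carrier M"
    using M by (auto simp: fd_simple_module_def simple_module_def double_jordan_def)
  let ?act = "\<lambda>p m. (?I +>\<^bsub>?F\<^esub> p) \<odot>\<^bsub>M\<^esub> m"
  interpret double_jordan_action M ?act
    by (intro double_jordan_action.intro ncpoly_action_char_0.intro double_jordan_action_axioms.intro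
        ncpoly_action_presented presented_relations_annihilate lm)
  have zero: "\<zero>\<^bsub>M\<^esub> \<in> common_kernel" by (simp add: common_kernel_def)
  have "submodule common_kernel double_jordan M"
  proof (intro submodule.intro submodule_axioms.intro add.subgroupI)
    show "c \<odot>\<^bsub>M\<^esub> n \<in> common_kernel" if "c \<in> carrier double_jordan" "n \<in> common_kernel" for c n
      using that common_kernel_act by (auto simp: A(5))
    show "common_kernel \<noteq> {}" using zero by blast
  qed (auto simp: common_kernel_def act_add_right act_uminus_right)
  moreover have "common_kernel \<noteq> {\<zero>\<^bsub>M\<^esub>}"
    using common_kernel_nonzero[OF presented_finitely_spanned[OF lm fd] nonzero] by blast
  ultimately have "common_kernel = carrier M" using simple by blast
  then have ann: "x \<in> annihilator" "u \<in> annihilator" "1 - g \<in> annihilator"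
    by (auto simp: common_kernel_def annihilator_def)
  let ?s = "ncpoly_subst sl2_lift" and ?t = "ncpoly_subst double_jordan_proj_gen"
  obtain p q where pq: "a = ?I +>\<^bsub>?F\<^esub> p" "b = ?I +>\<^bsub>?F\<^esub> q"
    using a by (auto simp: A(5))
  have "?t p - ?t q \<in> ?J"
    using a(3) B(6)[OF ncpoly_subst_double_jordan_proj_gen_closed ncpoly_subst_double_jordan_proj_gen_closed] by (simp add: pq double_jordan_proj_coset)
  then have "?s (?t p - ?t q) \<in> annihilator"
    using ideal_vimage_ncpoly_action[OF ncpoly_action_axioms sl2_relations_closed, of sl2_lift]
      sl2_lift_relations[OF ann(2,3)] by blast
  \<comment> \<open>Here \<open>p - q\<close> is
    \<open>(p - ?s (?t p)) - (q - ?s (?t q)) + ?s (?t p - ?t q)\<close>, with all three terms in the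
    annihilator.\<close>
  from annihilator_add[OF annihilator_diff[OF sl2_lift_proj[OF ann, of p] sl2_lift_proj[OF ann, of q]] this]
  have "p - q \<in> annihilator" by (simp add: ncpoly_subst_diff)
  from act_cong[OF this m] show ?thesis by (simp add: pq)
qed

theorem theorem3p11:
  shows "\<exists>\<Phi> :: (('k::{alg_closed_field, field_char_0} mat2, 'k) ncpoly set, 'm) module set
              \<Rightarrow> ((djgen, 'k) ncpoly set, 'm) module set.
           (\<forall>L. fd_simple_module U_sl2 L \<longrightarrow>
              \<Phi> (iso_class U_sl2 L) =
                iso_class double_jordan (restrict_scalars double_jordan_proj L)) \<and>
           bij_betw \<Phi> (irrep U_sl2) (irrep double_jordan)"
proof (rule irrep_bij_betw_restrict_scalars)
  show "ring (double_jordan :: ('k, _) module)" "ring (U_sl2 :: ('k, _) module)"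
    unfolding double_jordan_def U_sl2_def
    by (rule presented_algebra_simps(3) double_jordan_relations_closed sl2_relations_closed)+
  show "algebra_hom double_jordan U_sl2 (double_jordan_proj :: (djgen, 'k) ncpoly set \<Rightarrow> _)"
    using double_jordan_proj[where 'k = 'k] by (simp add: is_double_jordan_proj_def)
  show "c \<odot>\<^bsub>double_jordan\<^esub> \<one>\<^bsub>double_jordan\<^esub> \<in> carrier double_jordan" for c :: 'k
    unfolding double_jordan_def by (rule presented_algebra_smult_one_closed[OF double_jordan_relations_closed])
qed (fact double_jordan_proj_surj double_jordan_proj_kernel_annihilates)+

end
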